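(* Write $n(s):=n_5(5,2;s)$. The following bounds and exact values hold. (1) For $2\le s\le 31$: $27\le n(2)\le 31$; $50\le n(3)\le 62$; $77\le n(4)\le 93$; $n(5)=125$; $132\le n(6)\le 146$; $157\le n(7)\le 172$; $176\le n(8)\le 198$; $202\le n(9)\le 224$; $n(10)=250$; $260\le n(11)\le 271$; $286\le n(12)\le 297$; $308\le n(13)\le 323$; $330\le n(14)\le 349$; $n(15)=375$; $391\le n(16)\le 396$; $412\le n(17)\le 422$; $433\le n(18)\le 448$; $455\le n(19)\le 474$; $n(20)=500$; $n(21)=521$; $542\le n(22)\le 547$; $568\le n(23)\le 573$; $594\le n(24)\le 599$; $n(25)=625$; $n(26)=651$; $667\le n(27)\le 677$; $693\le n(28)\le 703$; $719\le n(29)\le 729$; $n(30)=755$; $n(31)=781$. (2) For $32\le s\le 62$: $792\le n(32)\le 802$; $818\le n(33)\le 828$; $844\le n(34)\le 854$; $n(35)=880$; $n(36)=906$; $n(37)=927$; $941\le n(38)\le 953$; $969\le n(39)\le 979$; $n(40)=1005$; $n(41)=1031$; $n(42)=1052$; $1067\le n(43)\le 1078$; $1096\le n(44)\le 1104$; $n(45)=1130$; $n(46)=1156$; $n(47)=1177$; $n(48)=1203$; $1224\le n(49)\le 1229$; $n(50)=1255$; $n(51)=1281$; $n(52)=1302$; $n(53)=1328$; $n(54)=1354$; $n(55)=1380$; $n(56)=1406$; $n(57)=1432$; $n(58)=1458$; $n(59)=1484$; $n(60)=1510$; $n(61)=1536$; $n(62)=1562$. (3) For every integer $t\ge 3$: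 $n(31t-30)=781t-760$; $n(31t-29)=781t-734$; $n(31t-28)=781t-708$; $n(31t-27)=781t-682$; $n(31t-26)=781t-656$; $n(31t-25)=781t-635$; $n(31t-24)=781t-609$; $n(31t-23)=781t-583$; $n(31t-22)=781t-557$; $n(31t-21)=781t-531$; $n(31t-20)=781t-510$; $n(31t-19)=781t-484$; $n(31t-18)=781t-458$; $n(31t-17)=781t-432$; $n(31t-16)=781t-406$; $n(31t-15)=781t-385$; $n(31t-14)=781t-359$; $n(31t-13)=781t-333$; $n(31t-12)=781t-307$; $n(31t-11)=781t-281$; $n(31t-10)=781t-260$; $n(31t-9)=781t-234$; $n(31t-8)=781t-208$; $n(31t-7)=781t-182$; $n(31t-6)=781t-156$; $n(31t-5)=781t-130$; $n(31t-4)=781t-104$; $n(31t-3)=781t-78$; $n(31t-2)=781t-52$; $n(31t-1)=781t-26$; $n(31t)=781t$.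
   Context: All dimensions are vector-space dimensions; a hyperplane of $\mathbb{F}_q^r$ is an $(r-1)$-dimensional subspace. A projective $h-(n,r,s)_q$ system is a multiset of $n$ subspaces of $\mathbb{F}_q^r$, each of dimension at most $h$, such that each hyperplane contains at most $s$ of these subspaces (counted with multiplicity) and some hyperplane contains exactly $s$ of them. $n_q(r,h;s)$ denotes the maximum $n$ such that a projective $h-(n,r,s)_q$ system exists. *)

theory Defs
  imports "HOL-Analysis.Analysis" "HOL-Library.Multiset"
begin

text \<open>
  The field \<open>\<F>\<^sub>q\<close> is a type \<open>'a::{field,finite}\<close> with \<open>q = CARD('a)\<close>, and the space
  \<open>\<F>\<^sub>q\<^sup>r\<close> is \<open>'a ^ 'r\<close> with \<open>r = CARD('r)\<close>. The prefix \<open>vec\<close> refers to linear algebra over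
  \<open>'a\<close> itself (scalar multiplication \<open>(*s)\<close>), not over the reals.
\<close>

definition hyperplane :: "('a::{field,finite} ^ 'r) set \<Rightarrow> bool" where
  "hyperplane H \<longleftrightarrow> vec.subspace H \<and> vec.dim H = CARD('r) - 1"

definition num_contained :: "('a::{field,finite} ^ 'r) set multiset \<Rightarrow> ('a ^ 'r) set \<Rightarrow> nat" where
  "num_contained M H = size {#U \<in># M. U \<subseteq> H#}"

definition projective_system ::
    "nat \<Rightarrow> nat \<Rightarrow> nat \<Rightarrow> ('a::{field,finite} ^ 'r) set multiset \<Rightarrow> bool" where
  "projective_system h n s M \<longleftrightarrow>
     size M = n \<and>
     (\<forall>U \<in># M. vec.subspace U \<and> vec.dim U \<le> h) \<and>
     (\<forall>H. hyperplane H \<longrightarrow> num_contained M H \<le> s) \<and>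
     (\<exists>H. hyperplane H \<and> num_contained M H = s)"

text \<open>
  The number \<open>n\<^sub>q(r,h;s)\<close>; the type argument carries \<open>q\<close> and \<open>r\<close>. For \<open>h < r\<close> the set below is
  nonempty (\<open>s\<close> copies of the zero subspace) and finite (each subspace of dimension at most \<open>h\<close>
  lies in one of the finitely many hyperplanes), so \<open>Max\<close> is a genuine maximum.
\<close>

definition max_system_size :: "('a::{field,finite} ^ 'r) itself \<Rightarrow> nat \<Rightarrow> nat \<Rightarrow> nat" where
  "max_system_size _ h s =
     Max {n. \<exists>M :: ('a ^ 'r) set multiset. projective_system h n s M}"

end

theory Submission
  imports Defs
begin

text \<open>
  Upper bounds. Replacing each subspace by a 2-dimensional one containing it, a hyperplane with \<open>c\<close> of
  the \<open>n\<close> lines has \<open>n + 5 c\<close> points, so the Griesmer argument (a chain of heaviest subspaces, compared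
  through pencils) gives
  \<open>\<lceil>(n - s) / 5\<rceil> + \<lceil>(n - s) / 25\<rceil> + \<lceil>(n - s) / 125\<rceil> \<le> 6 s\<close>. For \<open>s \<le> 4\<close> the 31 hyperplanes through a line
  of the system are better.

  Lower bounds. Systems can be added, so few building blocks suffice. Fix a plane \<open>E\<close> and the six
  solids \<open>S\<^sub>1, \<dots>, S\<^sub>6\<close> through it. A lifted MRD code is a set of 125 lines partitioning the points off
  \<open>E\<close>; a hyperplane other than the \<open>S\<^sub>i\<close> contains 5 of them, the \<open>S\<^sub>i\<close> contain none. A line spread of \<open>S\<^sub>i\<close>
  has 26 lines, one in each plane of \<open>S\<^sub>i\<close>. Hence \<open>b\<close> copies of the MRD code and \<open>y\<close> of the spreads give
  \<open>125 b + 26 y\<close> lines, at most \<open>5 b + y\<close> of them in a hyperplane other than the \<open>S\<^sub>i\<close>, which meets the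
  Griesmer bound in most cases. The remaining small systems are unions of orbits of small matrix groups,
  found by computer search.
\<close>

section \<open>Functionals and annihilators over a finite field\<close>

definition dotp :: "'a::field ^ 'n \<Rightarrow> 'a ^ 'n \<Rightarrow> 'a" where
  "dotp y x = (\<Sum>i\<in>UNIV. y $ i * x $ i)"

text \<open>The form \<open>dotp\<close> identifies the space with its dual, so \<open>ann\<close>
  plays two roles: functionals vanishing on a set, and points killed by given functionals.
  Hyperplanes appear as \<open>ann {y}\<close>.\<close>

definition ann :: "('a::field ^ 'n) set \<Rightarrow> ('a ^ 'n) set" where
  "ann U = {y. \<forall>x\<in>U. dotp y x = 0}"

lemma dotp_commute: "dotp y x = dotp x y"
  by (simp add: dotp_def mult.commute)

lemma dotp_add: "dotp y (x + x') = dotp y x + dotp y x'"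
  by (simp add: dotp_def distrib_left sum.distrib)

lemma dotp_scale: "dotp y (c *s x) = c * dotp y x"
  by (simp add: dotp_def sum_distrib_left mult.left_commute)

lemma dotp_add_left: "dotp (y + y') x = dotp y x + dotp y' x"
  by (metis dotp_add dotp_commute)

lemma dotp_scale_left: "dotp (c *s y) x = c * dotp y x"
  by (metis dotp_scale dotp_commute)

lemma dotp_zero [simp]: "dotp y 0 = 0" "dotp 0 x = 0"
  by (simp_all add: dotp_def)

lemma subspace_ann: "vec.subspace (ann U)"
  unfolding ann_def by (rule vec.subspaceI) (auto simp: dotp_add_left dotp_scale_left)

lemma ann_span: "ann (vec.span B) = ann B"
proof -
  have "dotp y x = 0" if "y \<in> ann B" "x \<in> vec.span B" for x y
    using that(2)
  proof (induction rule: vec.span_induct_alt)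
    case (step c b x)
    then show ?case using that(1) by (simp add: dotp_add dotp_scale ann_def)
  qed simp
  then show ?thesis
    by (auto simp: ann_def vec.span_base)
qed

lemma ann_insert: "ann (insert b B) = ann B \<inter> ann {b}"
  by (auto simp: ann_def)

lemma ann_empty: "ann {} = UNIV"
  by (simp add: ann_def)

lemma ann_Un: "ann (A \<union> B) = ann A \<inter> ann B"
  by (auto simp: ann_def)

lemma subset_ann_singleton: "U \<subseteq> ann {y} \<longleftrightarrow> y \<in> ann U"
  by (auto simp: ann_def dotp_commute)

lemma mem_ann_singleton: "x \<in> ann {y} \<longleftrightarrow> dotp y x = 0"
  by (simp add: ann_def dotp_commute)

lemma zero_in_ann [simp]: "0 \<in> ann U"
  by (simp add: ann_def)

lemma ann_scale: "c \<noteq> 0 \<Longrightarrow> ann {c *s y} = ann {y}"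
  by (auto simp: ann_def dotp_scale)

section \<open>Cardinalities of subspaces and annihilators\<close>

lemma card_span_insert:
  fixes B :: "('a::{field,finite} ^ 'n) set"
  assumes "b \<notin> vec.span B"
  shows "card (vec.span (insert b B)) = CARD('a) * card (vec.span B)"
proof -
  have "bij_betw (\<lambda>(c, x). x + c *s b) (UNIV \<times> vec.span B) (vec.span (insert b B))"
    unfolding bij_betw_def
  proof
    show "inj_on (\<lambda>(c, x). x + c *s b) (UNIV \<times> vec.span B)"
    proof (rule inj_onI, clarsimp)
      fix c c' x x' assume *: "x \<in> vec.span B" "x' \<in> vec.span B" "x + c *s b = x' + c' *s b"
      then have "(c - c') *s b = x' - x"
        by (simp add: algebra_simps vec.scale_left_diff_distrib)
      then have "(c - c') *s b \<in> vec.span B"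
        using * by (simp add: vec.span_diff)
      then have "inverse (c - c') *s ((c - c') *s b) \<in> vec.span B"
        by (rule vec.span_scale)
      moreover have "inverse (c - c') *s ((c - c') *s b) = b" if "c \<noteq> c'"
        using that by (simp only: vector_smult_assoc left_inverse right_minus_eq not_False_eq_True vec.scale_one)
      ultimately have "c = c'" using assms by metis
      then show "c = c' \<and> x = x'" using * by simp
    qed
    show "(\<lambda>(c, x). x + c *s b) ` (UNIV \<times> vec.span B) = vec.span (insert b B)"
    proof (intro equalityI subsetI)
      fix z assume "z \<in> (\<lambda>(c, x). x + c *s b) ` (UNIV \<times> vec.span B)"
      then obtain c x where z: "z = x + c *s b" and "x \<in> vec.span B" by auto
      then have "x \<in> vec.span (insert b B)"
        using vec.span_mono[OF subset_insertI] by blast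
      moreover have "c *s b \<in> vec.span (insert b B)"
        by (intro vec.span_scale vec.span_base insertI1)
      ultimately show "z \<in> vec.span (insert b B)"
        unfolding z by (rule vec.span_add)
    next
      fix z assume "z \<in> vec.span (insert b B)"
      then obtain k where "z - k *s b \<in> vec.span B"
        using vec.span_breakdown_eq by blast
      then show "z \<in> (\<lambda>(c, x). x + c *s b) ` (UNIV \<times> vec.span B)"
        by (intro image_eqI[where x = "(k, z - k *s b)"]) simp_all
    qed
  qed
  then have "card (vec.span (insert b B)) = card ((UNIV :: 'a set) \<times> vec.span B)"
    by (simp add: bij_betw_same_card)
  then show ?thesis by (simp add: card_cartesian_product)
qed

lemma card_span:
  fixes B :: "('a::{field,finite} ^ 'n) set"
  assumes "vec.independent B"
  shows "card (vec.span B) = CARD('a) ^ card B"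
proof -
  have "finite B" by simp
  then show ?thesis using assms
  proof (induction B)
    case (insert b B)
    then show ?case
      by (simp add: card_span_insert vec.independent_insert)
  qed simp
qed

lemma card_subspace:
  fixes A :: "('a::{field,finite} ^ 'n) set"
  assumes "vec.subspace A"
  shows "card A = CARD('a) ^ vec.dim A"
proof -
  obtain B where "B \<subseteq> A" "vec.independent B" "A \<subseteq> vec.span B" "card B = vec.dim A"
    using vec.basis_exists by blast
  moreover from this have "vec.span B = A"
    using vec.span_subspace[OF _ _ assms] by blast
  ultimately show ?thesis using card_span[of B] by simp
qed

text \<open>A functional that is nonzero on \<open>A\<close> takes every value equally often:
  \<open>A\<close> splits into the translates of its kernel by the multiples of one vector
  \<open>x0\<close> outside the kernel.\<close>

lemma card_Int_ann:
  fixes A :: "('a::{field,finite} ^ 'n) set"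
  assumes A: "vec.subspace A" and "\<not> A \<subseteq> ann {y}"
  shows "card A = CARD('a) * card (A \<inter> ann {y})"
proof -
  obtain x0 where x0: "x0 \<in> A" "dotp x0 y \<noteq> 0"
    using assms by (auto simp: ann_def)
  have "bij_betw (\<lambda>(c, x). x + c *s x0) (UNIV \<times> (A \<inter> ann {y})) A"
    unfolding bij_betw_def
  proof
    show "inj_on (\<lambda>(c, x). x + c *s x0) (UNIV \<times> (A \<inter> ann {y}))"
    proof (rule inj_onI, clarsimp)
      fix c c' x x' assume *: "x \<in> ann {y}" "x' \<in> ann {y}" "x + c *s x0 = x' + c' *s x0"
      then have "dotp (x + c *s x0) y = dotp (x' + c' *s x0) y" by simp
      then have "c = c'"
        using *(1,2) x0 by (simp add: dotp_add_left dotp_scale_left ann_def)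
      then show "c = c' \<and> x = x'" using * by simp
    qed
    show "(\<lambda>(c, x). x + c *s x0) ` (UNIV \<times> (A \<inter> ann {y})) = A"
    proof (intro equalityI subsetI)
      fix z assume "z \<in> (\<lambda>(c, x). x + c *s x0) ` (UNIV \<times> (A \<inter> ann {y}))"
      then obtain c x where z: "z = x + c *s x0" and "x \<in> A" by auto
      then show "z \<in> A"
        unfolding z by (intro vec.subspace_add[OF A] vec.subspace_scale[OF A] x0(1))
    next
      fix z assume z: "z \<in> A"
      define c where "c = dotp z y / dotp x0 y"
      have "dotp (z + (- c) *s x0) y = 0"
        unfolding dotp_add_left dotp_scale_left c_def using x0 by simp
      then have "z - c *s x0 \<in> A \<inter> ann {y}"
        using A z x0 by (simp add: ann_def vec.subspace_diff vec.subspace_scale)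
      then show "z \<in> (\<lambda>(c, x). x + c *s x0) ` (UNIV \<times> (A \<inter> ann {y}))"
        by (intro image_eqI[where x = "(c, z - c *s x0)"]) simp_all
    qed
  qed
  then have "card A = card ((UNIV :: 'a set) \<times> (A \<inter> ann {y}))"
    by (simp add: bij_betw_same_card)
  then show ?thesis by (simp add: card_cartesian_product)
qed

lemma card_ann_insert_ge:
  fixes B :: "('a::{field,finite} ^ 'n) set"
  shows "card (ann B) \<le> CARD('a) * card (ann (insert b B))"
proof (cases "ann B \<subseteq> ann {b}")
  case True
  then have "ann (insert b B) = ann B" using ann_insert[of b B] by blast
  then show ?thesis by simp
next
  case False
  then show ?thesis
    using card_Int_ann[OF subspace_ann False] by (simp add: ann_insert[of b B])
qed

lemma card_ann_Un_ge:
  fixes B C :: "('a::{field,finite} ^ 'n) set"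
  shows "card (ann B) \<le> CARD('a) ^ card C * card (ann (B \<union> C))"
proof -
  have "finite C" by simp
  then show ?thesis
  proof (induction C)
    case (insert c C)
    have "card (ann B) \<le> CARD('a) ^ card C * card (ann (B \<union> C))" by fact
    also have "\<dots> \<le> CARD('a) ^ card C * (CARD('a) * card (ann (insert c (B \<union> C))))"
      by (intro mult_le_mono2 card_ann_insert_ge)
    finally show ?case using insert by (simp add: algebra_simps)
  qed simp
qed

lemma card_ann_ge:
  fixes B :: "('a::{field,finite} ^ 'n) set"
  shows "CARD('a) ^ CARD('n) \<le> CARD('a) ^ card B * card (ann B)"
  using card_ann_Un_ge[of "{}" B] by (simp add: ann_empty CARD_vec)

lemma ann_UNIV: "ann (UNIV :: ('a::field ^ 'n) set) = {0}"
proof -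
  have "y = 0" if "y \<in> ann (UNIV :: ('a ^ 'n) set)" for y :: "'a ^ 'n"
  proof -
    have "y $ i = 0" for i
    proof -
      have "dotp y (axis i 1) = 0" using that by (simp add: ann_def)
      moreover have "dotp y (axis i 1) = y $ i"
        by (simp add: dotp_def axis_def if_distrib cong: if_cong)
      ultimately show ?thesis by simp
    qed
    then show ?thesis by (simp add: vec_eq_iff)
  qed
  then show ?thesis by auto
qed

text \<open>Each functional divides the size of the annihilator by at most \<open>q\<close>, and a basis reaches size 1
  after \<open>n\<close> steps, so every step divides by exactly \<open>q\<close>.\<close>

lemma card_ann:
  fixes B :: "('a::{field,finite} ^ 'n) set"
  assumes "vec.independent B"
  shows "card (ann B) * CARD('a) ^ card B = CARD('a) ^ CARD('n)"
proof -
  obtain C where C: "B \<subseteq> C" "vec.independent C" "UNIV \<subseteq> vec.span C"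
    using vec.maximal_independent_subset_extend[OF subset_UNIV assms] by auto
  have "card C = CARD('n)"
    using C(2,3) vec.dim_eq_card_independent[of C] vec.dim_span[of C]
    by (simp add: top.extremum_unique vec.dim_UNIV vec.dimension_def card_cart_basis)
  then have "card (C - B) + card B = CARD('n)"
    using C(1) card_mono[OF finite C(1)] by (simp add: card_Diff_subset)
  moreover have "ann C = {0}"
    using C(3) ann_UNIV[where 'a = 'a and 'n = 'n] ann_span[of C] by (simp add: top.extremum_unique)
  moreover have "B \<union> (C - B) = C" using C(1) by blast
  ultimately have "card (ann B) \<le> CARD('a) ^ card (C - B)"
    using card_ann_Un_ge[of B "C - B"] by simp
  then have "card (ann B) * CARD('a) ^ card B \<le> CARD('a) ^ card (C - B) * CARD('a) ^ card B"
    by simp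
  also have "\<dots> = CARD('a) ^ CARD('n)"
    using \<open>card (C - B) + card B = CARD('n)\<close> by (metis power_add)
  finally have "card (ann B) * CARD('a) ^ card B \<le> CARD('a) ^ CARD('n)" .
  then show ?thesis
    using card_ann_ge[of B] by (simp add: mult.commute)
qed

lemma card_ann_subspace:
  fixes U :: "('a::{field,finite} ^ 'n) set"
  shows "card (ann U) * CARD('a) ^ vec.dim U = CARD('a) ^ CARD('n)"
proof -
  obtain B where B: "B \<subseteq> U" "vec.independent B" "U \<subseteq> vec.span B" "card B = vec.dim U"
    using vec.basis_exists by blast
  have "vec.span B = vec.span U"
    using B vec.span_superset[of U] by (auto simp: vec.span_eq)
  then have "ann B = ann U" using ann_span by metis
  then show ?thesis using card_ann[OF B(2)] B(4) by simp
qed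

lemma one_less_CARD: "1 < CARD('a::{field,finite})"
proof -
  have "card {0, 1 :: 'a} \<le> CARD('a)" by (rule card_mono) auto
  then show ?thesis by simp
qed

lemma hyperplane_ann:
  fixes y :: "'a::{field,finite} ^ 'n"
  assumes "y \<noteq> 0"
  shows "hyperplane (ann {y})"
proof -
  have "vec.independent {y}" using assms by simp
  from card_ann[OF this] have *: "card (ann {y}) * CARD('a) = CARD('a) ^ CARD('n)" by simp
  have "card (ann {y}) = CARD('a) ^ vec.dim (ann {y})"
    by (rule card_subspace[OF subspace_ann])
  with * have "CARD('a) ^ Suc (vec.dim (ann {y})) = CARD('a) ^ CARD('n)"
    by (simp add: mult.commute)
  then have "Suc (vec.dim (ann {y})) = CARD('n)"
    using one_less_CARD[where 'a = 'a] power_inject_exp by blast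
  then show ?thesis unfolding hyperplane_def using subspace_ann[of "{y}"] by simp
qed

text \<open>Counting shows that \<open>CARD('a)\<close> functionals vanish on \<open>H\<close>, so a
  nonzero one does. Inclusion is the useful form because \<open>num_contained\<close> is monotone in
  the hyperplane.\<close>

lemma hyperplane_subset_ann:
  fixes H :: "('a::{field,finite} ^ 'n) set"
  assumes "hyperplane H"
  obtains y where "y \<noteq> 0" "H \<subseteq> ann {y}"
proof -
  have "CARD('a) ^ CARD('n) = CARD('a) ^ (CARD('n) - 1) * CARD('a)"
    by (metis One_nat_def Suc_diff_1 zero_less_card_finite power_Suc2)
  then have "card (ann H) * CARD('a) ^ (CARD('n) - 1) = CARD('a) * CARD('a) ^ (CARD('n) - 1)"
    using card_ann_subspace[of H] assms by (simp add: hyperplane_def)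
  then have "card (ann H) = CARD('a)" by simp
  then have "1 < card (ann H)" using one_less_CARD[where 'a = 'a] by simp
  have "ann H \<noteq> {0}"
  proof
    assume "ann H = {0}"
    with \<open>1 < card (ann H)\<close> show False by simp
  qed
  then obtain y where "y \<in> ann H" "y \<noteq> 0" using zero_in_ann[of H] by blast
  then show ?thesis using that by (auto simp: subset_ann_singleton[symmetric])
qed

section \<open>Upper bounds\<close>

text \<open>Here \<open>s\<close> is only an upper bound, because enlarging subspaces to lines can
  lower the maximal number in a hyperplane.\<close>

definition line_system :: "('a::{field,finite} ^ 'n) set multiset \<Rightarrow> nat \<Rightarrow> bool" where
  "line_system M s \<longleftrightarrow>
     (\<forall>U\<in>#M. vec.subspace U \<and> vec.dim U = 2) \<and> (\<forall>y. y \<noteq> 0 \<longrightarrow> num_contained M (ann {y}) \<le> s)"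

lemma num_contained_sum: "num_contained M H = (\<Sum>U\<in>#M. of_bool (U \<subseteq> H))"
  unfolding num_contained_def by (induction M) auto

lemma ex_dim2_superspace:
  fixes U :: "('a::{field,finite} ^ 'n) set"
  assumes "vec.subspace U" "vec.dim U \<le> 2" "2 \<le> CARD('n)"
  shows "\<exists>W. vec.subspace W \<and> U \<subseteq> W \<and> vec.dim W = 2"
proof -
  obtain B where B: "B \<subseteq> U" "vec.independent B" "U \<subseteq> vec.span B" "card B = vec.dim U"
    using vec.basis_exists by blast
  obtain C where C: "B \<subseteq> C" "vec.independent C" "UNIV \<subseteq> vec.span C"
    using vec.maximal_independent_subset_extend[OF subset_UNIV B(2)] by auto
  have "card C = CARD('n)"
    using C(2,3) vec.dim_eq_card_independent[of C] vec.dim_span[of C]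
    by (simp add: top.extremum_unique vec.dimension_def card_cart_basis)
  then obtain D where D: "B \<subseteq> D" "D \<subseteq> C" "card D = 2"
    using exists_subset_between[of B 2 C] B(4) C(1) assms by auto
  have "vec.dim (vec.span D) = 2"
    using vec.dim_span_eq_card_independent[OF vec.independent_mono[OF C(2) D(2)]] D(3) by simp
  moreover have "U \<subseteq> vec.span D"
    using B(3) vec.span_mono[OF D(1)] by blast
  ultimately show ?thesis using vec.subspace_span by blast
qed

lemma projective_system_imp_line_system:
  fixes M :: "('a::{field,finite} ^ 'n) set multiset"
  assumes M: "projective_system 2 n s M" and "2 \<le> CARD('n)"
  shows "\<exists>M' :: ('a ^ 'n) set multiset. size M' = n \<and> line_system M' s"
proof -
  have "\<forall>U\<in>#M. \<exists>W. vec.subspace W \<and> U \<subseteq> W \<and> vec.dim W = 2"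
    using M ex_dim2_superspace[OF _ _ assms(2)] unfolding projective_system_def by blast
  then obtain f where f: "\<And>U. U \<in># M \<Longrightarrow> vec.subspace (f U) \<and> U \<subseteq> f U \<and> vec.dim (f U) = 2"
    by metis
  have "num_contained (image_mset f M) H \<le> num_contained M H" for H
    unfolding num_contained_sum image_mset.compositionality comp_def
    by (rule sum_mset_mono) (use f in force)
  moreover have "num_contained M (ann {y}) \<le> s" if "y \<noteq> 0" for y
    using M hyperplane_ann[OF that] by (simp add: projective_system_def)
  ultimately have "line_system (image_mset f M) s"
    unfolding line_system_def using f le_trans by fastforce
  moreover have "size (image_mset f M) = n" using M by (simp add: projective_system_def)
  ultimately show ?thesis by blast
qed

section \<open>Counting through pencils of hyperplanes\<close>

text \<open>With \<open>a\<close> and \<open>b\<close> the values of \<open>y\<close> and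
  \<open>z\<close> at a point, this counts the members \<open>y + c *s z\<close> of a pencil that
  vanish there.\<close>

lemma count_root:
  fixes a b :: "'a::{field,finite}"
  shows "(\<Sum>c\<in>UNIV. of_bool (a + c * b = 0)) =
    (if b = 0 then if a = 0 then CARD('a) else 0 else 1 :: nat)"
proof (cases "b = 0")
  case False
  then have "a + c * b = 0 \<longleftrightarrow> c = - a / b" for c
    by (auto simp: field_simps eq_neg_iff_add_eq_0 add.commute)
  then show ?thesis using False by (simp add: of_bool_def)
qed auto

text \<open>Each point off \<open>ann {y, z}\<close> lies on exactly one hyperplane of the pencil spanned by \<open>y\<close> and \<open>z\<close>.\<close>

lemma card_pencil:
  fixes A :: "('a::{field,finite} ^ 'n) set"
  shows "card A + CARD('a) * card (A \<inter> ann {y} \<inter> ann {z}) =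
    card (A \<inter> ann {z}) + (\<Sum>c\<in>UNIV. card (A \<inter> ann {y + c *s z}))"
proof -
  have card: "card (A \<inter> B) = (\<Sum>x\<in>A. of_bool (x \<in> B))" for B
    by (simp add: of_bool_def sum.If_cases Int_def)
  have "card A + CARD('a) * card (A \<inter> (ann {y} \<inter> ann {z})) =
      (\<Sum>x\<in>A. 1 + CARD('a) * of_bool (dotp y x = 0 \<and> dotp z x = 0))"
    unfolding card sum.distrib by (simp add: sum_distrib_left mem_ann_singleton)
  \<comment> \<open>Pointwise: a vector killed by both \<open>y\<close> and \<open>z\<close> counts
    \<open>CARD('a) + 1\<close> times on either side, any other vector once.\<close>
  also have "\<dots> = (\<Sum>x\<in>A. of_bool (dotp z x = 0) +
      (\<Sum>c\<in>UNIV. of_bool (dotp y x + c * dotp z x = 0)))"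
    by (rule sum.cong) (simp_all add: count_root)
  also have "\<dots> = card (A \<inter> ann {z}) + (\<Sum>x\<in>A. \<Sum>c\<in>UNIV. of_bool (x \<in> ann {y + c *s z}))"
    unfolding card sum.distrib by (simp add: mem_ann_singleton dotp_add_left dotp_scale_left)
  also have "(\<Sum>x\<in>A. \<Sum>c\<in>UNIV. of_bool (x \<in> ann {y + c *s z})) =
      (\<Sum>c\<in>UNIV. card (A \<inter> ann {y + c *s z}))"
    unfolding card by (rule sum.swap)
  finally show ?thesis by (simp add: Int_assoc)
qed

text \<open>Incidences between members of \<open>M\<close> and vectors of \<open>W\<close>, the zero
  vector included. For subspaces the zero vector accounts for \<open>size M\<close>; over a field of
  5 elements the rest is four times the number of projective points, see
  \<open>mass_mod\<close>.\<close>

definition mass :: "('a::{field,finite} ^ 'n) set multiset \<Rightarrow> ('a ^ 'n) set \<Rightarrow> nat" where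
  "mass M W = (\<Sum>U\<in>#M. card (U \<inter> W))"

lemma mass_pencil:
  fixes M :: "('a::{field,finite} ^ 'n) set multiset"
  shows "mass M W + CARD('a) * mass M (W \<inter> ann {y} \<inter> ann {z}) =
    mass M (W \<inter> ann {z}) + (\<Sum>c\<in>UNIV. mass M (W \<inter> ann {y + c *s z}))"
proof (induction M)
  case (add U M)
  then show ?case
    using card_pencil[of "U \<inter> W" y z]
    by (simp add: mass_def sum.distrib Int_assoc algebra_simps)
qed (simp add: mass_def)

text \<open>Inside \<open>ann Y\<close>, none of the \<open>CARD('a) + 1\<close> members of the
  pencil through \<open>ann (insert z (insert y Y))\<close> is heavier than the one given by
  \<open>y\<close>; insert this into \<open>mass_pencil\<close>.\<close>

lemma mass_pencil_le:
  fixes M :: "('a::{field,finite} ^ 'n) set multiset"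
  assumes max: "\<And>v. v \<notin> vec.span Y \<Longrightarrow> mass M (ann (insert v Y)) \<le> mass M (ann (insert y Y))"
    and y: "y \<notin> vec.span Y" and z: "z \<notin> vec.span (insert y Y)"
  shows "mass M (ann Y) + CARD('a) * mass M (ann (insert z (insert y Y)))
    \<le> (CARD('a) + 1) * mass M (ann (insert y Y))"
proof -
  have "z \<notin> vec.span Y"
    using z vec.span_mono[OF subset_insertI] by blast
  \<comment> \<open>A member inside the span of \<open>Y\<close> would give \<open>y\<close> in that
    span if \<open>c = 0\<close>, and otherwise \<open>z\<close> in the span of
    \<open>insert y Y\<close>.\<close>
  moreover have "y + c *s z \<notin> vec.span Y" for c
  proof
    assume *: "y + c *s z \<in> vec.span Y"
    show False
    proof (cases "c = 0")
      case True
      with * y show False by simp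
    next
      case False
      have "y + c *s z \<in> vec.span (insert y Y)"
        using * vec.span_mono[OF subset_insertI] by blast
      moreover have "y \<in> vec.span (insert y Y)" by (simp add: vec.span_base)
      ultimately have "y + c *s z - y \<in> vec.span (insert y Y)" by (rule vec.span_diff)
      then have "c *s z \<in> vec.span (insert y Y)" by simp
      then have "inverse c *s (c *s z) \<in> vec.span (insert y Y)" by (rule vec.span_scale)
      moreover have "inverse c *s (c *s z) = z"
        by (simp only: vector_smult_assoc left_inverse[OF False] vec.scale_one)
      ultimately show False using z by simp
    qed
  qed
  ultimately have "mass M (ann (insert z Y)) + (\<Sum>c\<in>UNIV. mass M (ann (insert (y + c *s z) Y)))
      \<le> mass M (ann (insert y Y)) + (\<Sum>c\<in>(UNIV :: 'a set). mass M (ann (insert y Y)))"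
    by (intro add_mono sum_mono max)
  moreover have "ann Y \<inter> ann {v} = ann (insert v Y)" for v :: "'a ^ 'n"
    using ann_insert[of v Y] by simp
  moreover have "ann Y \<inter> ann {y} \<inter> ann {z} = ann (insert z (insert y Y))"
    by (auto simp: ann_def)
  ultimately show ?thesis
    using mass_pencil[of M "ann Y" y z] by (simp add: algebra_simps)
qed

text \<open>One step of a greedy descent: a heaviest subspace of codimension one in
  \<open>ann Y\<close>.\<close>

lemma ex_max_mass:
  fixes Y :: "('a::{field,finite} ^ 'n) set"
  assumes "vec.independent Y" "card Y < CARD('n)"
  shows "\<exists>y. y \<notin> vec.span Y \<and> vec.independent (insert y Y) \<and> card (insert y Y) = Suc (card Y) \<and>
    (\<forall>v. v \<notin> vec.span Y \<longrightarrow> mass M (ann (insert v Y)) \<le> mass M (ann (insert y Y)))"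
proof -
  have "vec.span Y \<noteq> UNIV"
  proof
    assume "vec.span Y = UNIV"
    then have "vec.dim (UNIV :: ('a ^ 'n) set) = card Y"
      using vec.dim_span_eq_card_independent[OF assms(1)] by simp
    then show False
      using assms(2) by (simp add: vec.dimension_def card_cart_basis)
  qed
  then have "Max ((\<lambda>v. mass M (ann (insert v Y))) ` (- vec.span Y)) \<in> (\<lambda>v. mass M (ann (insert v Y))) ` (- vec.span Y)"
    by (intro Max_in) auto
  then obtain y where y: "y \<notin> vec.span Y"
    "Max ((\<lambda>v. mass M (ann (insert v Y))) ` (- vec.span Y)) = mass M (ann (insert y Y))"
    by auto
  then have "mass M (ann (insert v Y)) \<le> mass M (ann (insert y Y))" if "v \<notin> vec.span Y" for v
    using that Max_ge[of "(\<lambda>v. mass M (ann (insert v Y))) ` (- vec.span Y)"] by fastforce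
  moreover have "y \<notin> Y" using y(1) vec.span_base by blast
  ultimately show ?thesis
    using y(1) assms(1) by (intro exI[of _ y]) (simp add: vec.independent_insert)
qed

section \<open>The Griesmer bound over the field of 5 elements\<close>

text \<open>The witness \<open>p\<close> is the number of projective points of
  \<open>A\<close>.\<close>

lemma subspace_card_mod:
  fixes A :: "('a::{field,finite} ^ 'n) set"
  assumes "CARD('a) = 5" "vec.subspace A"
  shows "\<exists>p. card A = 1 + 4 * p"
proof -
  have "\<exists>p. (5::nat) ^ k = 1 + 4 * p" for k :: nat
  proof (induction k)
    case (Suc k)
    then obtain p where "(5::nat) ^ k = 1 + 4 * p" by blast
    then have "(5::nat) ^ Suc k = 1 + 4 * (1 + 5 * p)" by simp
    then show ?case by blast
  qed simp
  then show ?thesis using card_subspace[OF assms(2)] assms(1) by simp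
qed

lemma mass_mod:
  fixes M :: "('a::{field,finite} ^ 'n) set multiset"
  assumes "CARD('a) = 5" "\<And>U. U \<in># M \<Longrightarrow> vec.subspace U" "vec.subspace W"
  shows "\<exists>p. mass M W = size M + 4 * p"
  using assms(2)
proof (induction M)
  case (add U M)
  then obtain p where "mass M W = size M + 4 * p" by auto
  moreover obtain r where "card (U \<inter> W) = 1 + 4 * r"
    using subspace_card_mod[OF assms(1) vec.subspace_inter[of U W]] add.prems assms(3) by auto
  ultimately have "mass (add_mset U M) W = size (add_mset U M) + 4 * (p + r)"
    by (simp add: mass_def)
  then show ?case by blast
qed (simp add: mass_def)

lemma mass_ann_singleton:
  fixes M :: "('a::{field,finite} ^ 'n) set multiset"
  assumes "CARD('a) = 5" "\<And>U. U \<in># M \<Longrightarrow> vec.subspace U \<and> vec.dim U = 2"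
  shows "mass M (ann {y}) = 5 * size M + 20 * num_contained M (ann {y})"
  using assms(2)
proof (induction M)
  case (add U M)
  then have U: "vec.subspace U" "card U = 25"
    using card_subspace[of U] assms(1) by auto
  have "card (U \<inter> ann {y}) = 5 + 20 * of_bool (U \<subseteq> ann {y})"
  proof (cases "U \<subseteq> ann {y}")
    case True
    then show ?thesis using U(2) by (simp add: Int_absorb2)
  next
    case False
    then show ?thesis using card_Int_ann[OF U(1) False] U(2) assms(1) by simp
  qed
  then show ?case using add by (simp add: mass_def num_contained_sum)
qed (simp add: mass_def num_contained_sum)

text \<open>Along the chain, \<open>n + 5 * c\<close>, \<open>p2\<close>, \<open>p3\<close>,
  \<open>p4\<close> are the point counts in dimensions 4, 3, 2, 1. The pencil inequalities say that
  each drop is at most 5 times the next. The first drop inside the hyperplane is at least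
  \<open>n - c\<close>, so the later drops \<open>e3\<close>, \<open>e4\<close> and the remainder
  \<open>p4\<close> add up to at most \<open>6 * c\<close>, while they are at least
  \<open>n - s\<close> divided by 5, 25 and 125, rounded up.\<close>

lemma griesmer_chain:
  fixes n s c p2 p3 p4 :: nat
  assumes "6 * n + 5 * p2 \<le> 6 * (n + 5 * c)" "n + 5 * c + 5 * p3 \<le> 6 * p2"
    "p2 + 5 * p4 \<le> 6 * p3" "p3 \<le> 6 * p4" "c \<le> s"
  shows "(n - s + 4) div 5 + (n - s + 24) div 25 + (n - s + 124) div 125 \<le> 6 * s"
proof -
  \<comment> \<open>Signed differences, since nothing orders these counts in advance.\<close>
  define d e2 e3 e4 :: int where
    "d = int n - int s" and "e2 = int n + 5 * int c - int p2" and
    "e3 = int p2 - int p3" and "e4 = int p3 - int p4"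
  note e = d_def e2_def e3_def e4_def
  have "d \<le> e2" "e2 \<le> 5 * e3" "e3 \<le> 5 * e4" "e4 \<le> 5 * int p4" "e3 + e4 + int p4 \<le> 6 * int s"
    using assms unfolding e by (simp_all add: algebra_simps)
  then have "d \<le> 5 * e3" "d \<le> 25 * e4" "d \<le> 125 * int p4" and e: "e3 + e4 + int p4 \<le> 6 * int s"
    by simp_all
  have "(d + 4) div 5 \<le> e3"
    using zdiv_mono1[of "d + 4" "4 + 5 * e3" 5] \<open>d \<le> 5 * e3\<close> by simp
  moreover have "(d + 24) div 25 \<le> e4"
    using zdiv_mono1[of "d + 24" "24 + 25 * e4" 25] \<open>d \<le> 25 * e4\<close> by simp
  moreover have "(d + 124) div 125 \<le> int p4"
    using zdiv_mono1[of "d + 124" "124 + 125 * int p4" 125] \<open>d \<le> 125 * int p4\<close> by simp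
  ultimately have *: "(d + 4) div 5 + (d + 24) div 25 + (d + 124) div 125 \<le> 6 * int s"
    using e by simp
  \<comment> \<open>For \<open>n < s\<close> truncated subtraction turns the left side into
    \<open>4 div 5 + 24 div 25 + 124 div 125\<close>, which is 0.\<close>
  show ?thesis
  proof (cases "s \<le> n")
    case True
    then have "int (n - s) = d" by (simp add: d_def of_nat_diff)
    then have "int ((n - s + 4) div 5 + (n - s + 24) div 25 + (n - s + 124) div 125)
        = (d + 4) div 5 + (d + 24) div 25 + (d + 124) div 125"
      by (simp add: zdiv_int)
    with * show ?thesis by linarith
  qed simp
qed

theorem griesmer:
  fixes M :: "('a::{field,finite} ^ 5) set multiset"
  assumes q: "CARD('a) = 5" and M: "line_system M s"
  shows "(size M - s + 4) div 5 + (size M - s + 24) div 25 + (size M - s + 124) div 125 \<le> 6 * s"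
proof -
  let ?m = "\<lambda>Y. mass M (ann Y)"
  define n where "n = size M"
  have sub: "vec.subspace U" "vec.dim U = 2" if "U \<in># M" for U
    using M that by (auto simp: line_system_def)
  \<comment> \<open>Five greedy choices give a flag of annihilators of dimensions 4, 3, 2, 1, 0,
    each a heaviest one inside its predecessor.\<close>
  have "card ({} :: ('a ^ 5) set) < CARD(5)" by simp
  from ex_max_mass[OF vec.independent_empty this, of M] obtain y1 where y1:
    "y1 \<notin> vec.span {}" "vec.independent {y1}" "card {y1} = Suc (card ({} :: ('a ^ 5) set))"
    "\<forall>v. v \<notin> vec.span {} \<longrightarrow> ?m {v} \<le> ?m {y1}"
    by (elim exE conjE) (rule that; assumption)
  have "card ({y1}) < CARD(5)" using y1(3) by simp
  from ex_max_mass[OF y1(2) this, of M] obtain y2 where y2: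
    "y2 \<notin> vec.span {y1}" "vec.independent {y2, y1}" "card {y2, y1} = Suc (card {y1})"
    "\<forall>v. v \<notin> vec.span {y1} \<longrightarrow> ?m {v, y1} \<le> ?m {y2, y1}"
    by (elim exE conjE) (rule that; assumption)
  have "card ({y2, y1}) < CARD(5)" using y2(3) y1(3) by simp
  from ex_max_mass[OF y2(2) this, of M] obtain y3 where y3:
    "y3 \<notin> vec.span {y2, y1}" "vec.independent {y3, y2, y1}" "card {y3, y2, y1} = Suc (card {y2, y1})"
    "\<forall>v. v \<notin> vec.span {y2, y1} \<longrightarrow> ?m {v, y2, y1} \<le> ?m {y3, y2, y1}"
    by (elim exE conjE) (rule that; assumption)
  have "card ({y3, y2, y1}) < CARD(5)" using y3(3) y1(3) y2(3) by simp
  from ex_max_mass[OF y3(2) this, of M] obtain y4 where y4: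
    "y4 \<notin> vec.span {y3, y2, y1}" "vec.independent {y4, y3, y2, y1}" "card {y4, y3, y2, y1} = Suc (card {y3, y2, y1})"
    "\<forall>v. v \<notin> vec.span {y3, y2, y1} \<longrightarrow> ?m {v, y3, y2, y1} \<le> ?m {y4, y3, y2, y1}"
    by (elim exE conjE) (rule that; assumption)
  have "card ({y4, y3, y2, y1}) < CARD(5)" using y4(3) y1(3) y2(3) y3(3) by simp
  from ex_max_mass[OF y4(2) this, of M] obtain y5 where y5:
    "y5 \<notin> vec.span {y4, y3, y2, y1}" "vec.independent {y5, y4, y3, y2, y1}" "card {y5, y4, y3, y2, y1} = Suc (card {y4, y3, y2, y1})"
    "\<forall>v. v \<notin> vec.span {y4, y3, y2, y1} \<longrightarrow> ?m {v, y4, y3, y2, y1} \<le> ?m {y5, y4, y3, y2, y1}"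
    by (elim exE conjE) (rule that; assumption)
  have "\<exists>p. ?m Y = n + 4 * p" for Y
    unfolding n_def by (rule mass_mod[OF q]) (use sub subspace_ann in auto)
  then obtain p where p: "\<And>Y. ?m Y = n + 4 * p Y" by metis
  have "card (ann {y5, y4, y3, y2, y1}) = 1"
    using card_ann[OF y5(2)] y5(3) y4(3) y3(3) y2(3) y1(3) q by simp
  then have "ann {y5, y4, y3, y2, y1} = {0}"
    using zero_in_ann[of "{y5, y4, y3, y2, y1}"] by (metis card_1_singletonE singletonD)
  moreover have "mass M {0} = n"
    unfolding mass_def n_def using sub
  proof (induction M)
    case (add U M)
    then have "U \<inter> {0} = {0}" using vec.subspace_0[of U] by auto
    then show ?case using add by simp
  qed simp
  ultimately have p5: "p {y5, y4, y3, y2, y1} = 0"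
    using p[of "{y5, y4, y3, y2, y1}"] by simp
  have "?m {} = 25 * n"
    unfolding ann_empty mass_def n_def using sub
  proof (induction M)
    case (add U M)
    then show ?case using card_subspace[of U] q by simp
  qed simp
  then have p0: "p {} = 6 * n" using p[of "{}"] by simp
  define c where "c = num_contained M (ann {y1})"
  have "c \<le> s" using M y1(1) by (simp add: line_system_def c_def)
  have p1: "p {y1} = n + 5 * c"
    using mass_ann_singleton[OF q, of M y1] sub p[of "{y1}"] by (simp add: c_def n_def)
  \<comment> \<open>Each mass is \<open>n + 4 * p\<close>; as 1 + 5 = 6, the terms in
    \<open>n\<close> cancel and the pencil inequality passes to \<open>p\<close>.\<close>
  have s2: "p {} + 5 * p {y2, y1} \<le> 6 * p {y1}"
    using mass_pencil_le[OF y1(4)[rule_format] y1(1) y2(1)] p q by simp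
  have s3: "p {y1} + 5 * p {y3, y2, y1} \<le> 6 * p {y2, y1}"
    using mass_pencil_le[OF y2(4)[rule_format] y2(1) y3(1)] p q by simp
  have s4: "p {y2, y1} + 5 * p {y4, y3, y2, y1} \<le> 6 * p {y3, y2, y1}"
    using mass_pencil_le[OF y3(4)[rule_format] y3(1) y4(1)] p q by simp
  have s5: "p {y3, y2, y1} \<le> 6 * p {y4, y3, y2, y1}"
    using mass_pencil_le[OF y4(4)[rule_format] y4(1) y5(1)] p q p5 by simp
  show ?thesis
    unfolding n_def[symmetric]
    by (rule griesmer_chain[OF s2[unfolded p0 p1] s3[unfolded p1] s4 s5 \<open>c \<le> s\<close>])
qed

section \<open>Hyperplanes through a line\<close>

text \<open>Double counting of pairs of a nonzero functional killing \<open>A\<close> and a member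
  of \<open>M\<close> that it kills; the 1 subtracted is the zero functional.\<close>

lemma sum_num_contained:
  fixes M :: "('a::{field,finite} ^ 'n) set multiset"
  shows "(\<Sum>y\<in>ann A - {0}. num_contained M (ann {y})) = (\<Sum>U\<in>#M. card (ann (A \<union> U)) - 1)"
proof (induction M)
  case (add U M)
  have "(\<Sum>y\<in>ann A - {0}. of_bool (U \<subseteq> ann {y})) = card ((ann A - {0}) \<inter> ann U)"
    by (simp add: subset_ann_singleton of_bool_def sum.If_cases Int_def)
  also have "(ann A - {0}) \<inter> ann U = ann (A \<union> U) - {0}"
    by (auto simp: ann_def)
  finally have "(\<Sum>y\<in>ann A - {0}. of_bool (U \<subseteq> ann {y})) = card (ann (A \<union> U)) - 1"
    by simp
  then show ?case
    using add by (simp add: num_contained_sum sum.distrib)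
qed (simp add: num_contained_sum)

lemma dim2_eq_span:
  fixes U :: "('a::{field,finite} ^ 'n) set"
  assumes "vec.subspace U" "vec.dim U = 2" "P \<in> U" "P \<noteq> 0"
  shows "\<exists>a. U = vec.span {P, a}"
proof -
  have "vec.independent {P}" using assms(4) by simp
  then obtain B where B: "{P} \<subseteq> B" "B \<subseteq> U" "vec.independent B" "U \<subseteq> vec.span B"
    using vec.maximal_independent_subset_extend[of "{P}" U] assms(3) by auto
  then have "vec.span B = U" using vec.span_subspace assms(1) by blast
  moreover have "card B = 2"
    using vec.dim_span_eq_card_independent[OF B(3)] calculation assms(2) by simp
  then have "card (B - {P}) = 1" using B(1) by simp
  then obtain a where "B - {P} = {a}" by (rule card_1_singletonE)
  then have "B = {P, a}" using B(1) by blast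
  ultimately show ?thesis by blast
qed

lemma dim2_ex_nonzero:
  fixes U :: "('a::{field,finite} ^ 'n) set"
  assumes "vec.subspace U" "vec.dim U = 2"
  obtains P where "P \<in> U" "P \<noteq> 0"
proof -
  have "card U > 1"
    using card_subspace[OF assms(1)] assms(2) one_less_power[OF one_less_CARD[where 'a = 'a], of 2] by simp
  then have "\<not> U \<subseteq> {0}" using card_mono[of "{0}" U] by auto
  then show ?thesis using that by blast
qed

text \<open>\<open>T\<close> is a union of orbits of the nonzero scalars, each of size
  \<open>CARD('a) - 1\<close>; the induction removes one orbit \<open>R\<close> at a time.\<close>

lemma card_scaling_closed:
  fixes T :: "('a::{field,finite} ^ 'n) set"
  assumes "0 \<notin> T" "\<And>c y. c \<noteq> 0 \<Longrightarrow> y \<in> T \<Longrightarrow> c *s y \<in> T"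
  shows "CARD('a) - 1 dvd card T"
proof -
  have "finite T" by simp
  then show ?thesis using assms
  proof (induction T rule: finite_psubset_induct)
    case (psubset T)
    show ?case
    proof (cases "T = {}")
      case False
      then obtain y where y: "y \<in> T" by blast
      then have "y \<noteq> 0" using psubset.prems(1) by blast
      define R where "R = (\<lambda>c. c *s y) ` (- {0})"
      have R: "R \<subseteq> T" using psubset.prems(2)[OF _ y] by (auto simp: R_def)
      have "inj_on (\<lambda>c. c *s y) (- {0})"
        using \<open>y \<noteq> 0\<close> by (auto simp: inj_on_def)
      then have "card R = CARD('a) - 1"
        unfolding R_def by (simp add: card_image Compl_eq_Diff_UNIV card_Diff_subset)
      moreover have "CARD('a) - 1 dvd card (T - R)"
      proof (rule psubset.IH)
        have "y \<in> R" unfolding R_def by (rule image_eqI[of _ _ 1]) simp_all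
        then show "T - R \<subset> T" using y by blast
        show "0 \<notin> T - R" using psubset.prems(1) by blast
        fix c z assume cz: "c \<noteq> (0 :: 'a)" "z \<in> T - R"
        have "c *s z \<notin> R"
        proof
          assume "c *s z \<in> R"
          then obtain d where d: "d \<noteq> 0" "c *s z = d *s y" by (auto simp: R_def)
          have "z = inverse c *s (c *s z)"
            by (simp only: vector_smult_assoc left_inverse[OF cz(1)] vec.scale_one)
          also have "\<dots> = (inverse c * d) *s y"
            by (simp only: d(2) vector_smult_assoc)
          finally have "z \<in> R" using d(1) cz(1) by (auto simp: R_def)
          with cz(2) show False by simp
        qed
        then show "c *s z \<in> T - R" using psubset.prems(2) cz by blast
      qed
      moreover have "card T = card R + card (T - R)"
        using R card_mono[OF psubset.hyps R] by (simp add: card_Diff_subset)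
      ultimately show ?thesis by (metis dvd_add dvd_refl)
    qed simp
  qed
qed

context
  fixes M :: "('a::{field,finite} ^ 5) set multiset" and s :: nat
  assumes q: "CARD('a) = 5" and M: "line_system M s"
begin

lemma
  assumes "U \<in># M"
  shows line_subspace: "vec.subspace U" and line_dim: "vec.dim U = 2"
  using M assms by (auto simp: line_system_def)

lemma card_ann_line: "U \<in># M \<Longrightarrow> card (ann U) = 125"
  using card_ann_subspace[of U] line_dim q by simp

text \<open>Two lines span at most 4 dimensions, and at most 3 if they share the point
  \<open>P\<close>; this leaves at least 5 or 25 of the 3125 functionals.\<close>

lemma card_ann_two_lines:
  assumes "U \<in># M" "L \<in># M"
  shows "5 \<le> card (ann (L \<union> U))"
    and "P \<in> L \<Longrightarrow> P \<in> U \<Longrightarrow> P \<noteq> 0 \<Longrightarrow> 25 \<le> card (ann (L \<union> U))"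
proof -
  have span: "ann (vec.span {P, a} \<union> vec.span {Q, b}) = ann {P, a, Q, b}" for P a Q b :: "'a ^ 5"
    unfolding ann_Un ann_span by (auto simp: ann_def)
  have ge: "3125 \<le> 5 ^ card B * card (ann B)" for B :: "('a ^ 5) set"
    using card_ann_ge[of B] q by simp
  obtain R Q where "R \<in> L" "R \<noteq> 0" "Q \<in> U" "Q \<noteq> 0"
    using dim2_ex_nonzero line_subspace line_dim assms by metis
  then obtain a b where "L = vec.span {R, a}" "U = vec.span {Q, b}"
    using dim2_eq_span line_subspace line_dim assms by metis
  then have "ann (L \<union> U) = ann {R, a, Q, b}" by (simp add: span)
  then have "3125 \<le> 5 ^ card {R, a, Q, b} * card (ann (L \<union> U))" using ge by metis
  also have "\<dots> \<le> 5 ^ 4 * card (ann (L \<union> U))"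
    by (intro mult_le_mono1 power_increasing) (auto simp: card_insert_if)
  finally show "5 \<le> card (ann (L \<union> U))" by simp
  assume P: "P \<in> L" "P \<in> U" "P \<noteq> 0"
  then obtain a b where "L = vec.span {P, a}" "U = vec.span {P, b}"
    using dim2_eq_span line_subspace line_dim assms by metis
  then have "ann (L \<union> U) = ann {P, a, P, b}" by (simp only: span)
  also have "{P, a, P, b} = {P, a, b}" by blast
  finally have "ann (L \<union> U) = ann {P, a, b}" .
  then have "3125 \<le> 5 ^ card {P, a, b} * card (ann (L \<union> U))" using ge by metis
  also have "\<dots> \<le> 5 ^ 3 * card (ann (L \<union> U))"
    by (intro mult_le_mono1 power_increasing) (auto simp: card_insert_if)
  finally show "25 \<le> card (ann (L \<union> U))" by simp
qed

text \<open>Sum over the 124 nonzero functionals killing \<open>L\<close>: \<open>L\<close> itself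
  contributes 124, every other line at least 4, and the total is at most \<open>124 * s\<close>.
  Equality makes each of these estimates sharp.\<close>

lemma line_bound:
  assumes L: "L \<in># M"
  shows "size M \<le> 31 * (s - 1) + 1"
    and "size M = 31 * (s - 1) + 1 \<Longrightarrow> y \<in> ann L \<Longrightarrow> y \<noteq> 0 \<Longrightarrow> num_contained M (ann {y}) = s"
    and "size M = 31 * (s - 1) + 1 \<Longrightarrow> U \<in># M - {#L#} \<Longrightarrow> card (ann (L \<union> U)) = 5"
    and "1 \<le> s"
proof -
  define N where "N = M - {#L#}"
  have MN: "M = add_mset L N" using L by (simp add: N_def)
  \<comment> \<open>Stated for every part of \<open>N\<close>, so that a single line can be set
    aside later.\<close>
  have lower: "4 * size N' \<le> (\<Sum>U\<in>#N'. card (ann (L \<union> U)) - 1)" if "N' \<subseteq># N" for N'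
    using that
  proof (induction N')
    case (add U N')
    then have "U \<in># M" using MN by (metis insert_iff mset_subset_eq_insertD set_mset_add_mset_insert)
    then have "5 \<le> card (ann (L \<union> U))" using card_ann_two_lines(1) L by blast
    moreover have "N' \<subseteq># N" using add.prems by (metis mset_subset_eq_insertD subset_mset.less_imp_le)
    ultimately show ?case using add.IH by simp
  qed simp
  have c: "num_contained M (ann {y}) \<le> s" if "y \<noteq> 0" for y
    using M that by (simp add: line_system_def)
  have card: "card (ann L - {0}) = 124" using card_ann_line[OF L] by simp
  have sum: "(\<Sum>y\<in>ann L - {0}. num_contained M (ann {y})) = 124 + (\<Sum>U\<in>#N. card (ann (L \<union> U)) - 1)"
    unfolding sum_num_contained using MN card_ann_line[OF L] by simp
  have upper: "(\<Sum>y\<in>ann L - {0}. num_contained M (ann {y})) \<le> 124 * s"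
    using sum_bounded_above[of "ann L - {0}" "\<lambda>y. num_contained M (ann {y})" s] c card by simp
  have main: "124 + 4 * size N \<le> 124 * s" using sum upper lower[of N] by simp
  then show "1 \<le> s" by simp
  then show "size M \<le> 31 * (s - 1) + 1" using main MN by simp
  assume eq: "size M = 31 * (s - 1) + 1"
  then have N: "124 + 4 * size N = 124 * s" using \<open>1 \<le> s\<close> MN by simp
  have sums: "(\<Sum>y\<in>ann L - {0}. num_contained M (ann {y})) = 124 * s"
    "(\<Sum>U\<in>#N. card (ann (L \<union> U)) - 1) = 4 * size N"
    using sum upper lower[of N] N by simp_all
  show "num_contained M (ann {y}) = s" if y: "y \<in> ann L" "y \<noteq> 0"
  proof -
    have "(\<Sum>y\<in>ann L - {0}. num_contained M (ann {y})) = (\<Sum>y\<in>ann L - {0}. s)"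
      using sums(1) card by simp
    then show ?thesis
      by (rule sum_mono_inv) (use c y in auto)
  qed
  show "card (ann (L \<union> U)) = 5" if U: "U \<in># M - {#L#}"
  proof -
    \<comment> \<open>The other lines use up at least \<open>4 * size N'\<close> of the total, which
      leaves at most 4 for \<open>U\<close>.\<close>
    define N' where "N' = N - {#U#}"
    have "U \<in># N" using U by (simp only: N_def)
    then have NN: "N = add_mset U N'" unfolding N'_def by (rule insert_DiffM[symmetric])
    then have "4 * size N' \<le> (\<Sum>U\<in>#N'. card (ann (L \<union> U)) - 1)" by (intro lower) simp
    moreover have "U \<in># M" using U by (meson in_diffD)
    then have "5 \<le> card (ann (L \<union> U))" using card_ann_two_lines(1) L by blast
    ultimately show ?thesis using sums(2) NN by simp
  qed
qed

text \<open>In the equality case the lines are pairwise disjoint and every hyperplane contains 0 or \<open>s\<close> of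
  them. Counting incident pairs at a point of a line shows that \<open>s\<close> divides \<open>31 (6 s - 5)\<close>.\<close>

lemma line_bound_eq:
  assumes "size M = 31 * (s - 1) + 1"
  shows "s dvd 31 + 186 * (s - 1)"
proof -
  have "M \<noteq> {#}" using assms by auto
  then obtain L where L: "L \<in># M" by blast
  obtain P where P: "P \<in> L" "P \<noteq> 0"
    using dim2_ex_nonzero line_subspace[OF L] line_dim[OF L] by metis
  have "s \<ge> 1" using line_bound(4)[OF L] .
  define N where "N = M - {#L#}"
  have MN: "M = add_mset L N" using L by (simp add: N_def)
  \<comment> \<open>\<open>P\<close> is off \<open>U\<close>, since a common point would leave 25
    functionals instead of 5; so \<open>U\<close> and \<open>P\<close> span 3 dimensions, which
    leaves exactly 25.\<close>
  have U: "card (ann (insert P U)) = 25" if "U \<in># N" for U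
  proof -
    have UM: "U \<in># M" using that MN by simp
    have "card (ann (L \<union> U)) = 5" using line_bound(3)[OF L assms] that by (simp add: N_def)
    then have "P \<notin> U" using card_ann_two_lines(2)[OF UM L P(1) _ P(2)] by auto
    obtain Q where Q: "Q \<in> U" "Q \<noteq> 0"
      using dim2_ex_nonzero line_subspace[OF UM] line_dim[OF UM] by metis
    have "\<not> ann U \<subseteq> ann {P}"
    proof
      assume "ann U \<subseteq> ann {P}"
      then have "ann (insert P U) = ann U" by (auto simp: ann_def)
      moreover obtain B where B: "B \<subseteq> U" "vec.independent B" "U \<subseteq> vec.span B" "card B = 2"
        using vec.basis_exists[of U] line_dim[OF UM] by metis
      have span: "vec.span B = U" using vec.span_subspace[OF B(1,3) line_subspace[OF UM]] .
      then have "vec.independent (insert P B)" "P \<notin> B"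
        using B(2) \<open>P \<notin> U\<close> vec.span_base[of P B] by (auto simp: vec.independent_insert)
      then have "card (ann (insert P B)) * 125 = 3125"
        using card_ann[of "insert P B"] B(4) q by simp
      moreover have "ann (insert P B) = ann (insert P U)"
        using ann_insert[of P B] ann_insert[of P U] ann_span[of B] span by simp
      ultimately show False using card_ann_line[OF UM] by simp
    qed
    then have "125 = 5 * card (ann U \<inter> ann {P})"
      using card_Int_ann[OF subspace_ann] card_ann_line[OF UM] q by metis
    then show ?thesis using ann_insert[of P U] by simp
  qed
  \<comment> \<open>The hyperplanes through \<open>P\<close> that contain some line; by sharpness
    they contain exactly \<open>s\<close>.\<close>
  define T where "T = {y \<in> ann {P} - {0}. num_contained M (ann {y}) \<noteq> 0}"
  have "num_contained M (ann {y}) = s" if "y \<in> T" for y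
  proof -
    have "{#U \<in># M. U \<subseteq> ann {y}#} \<noteq> {#}" using that by (auto simp: T_def num_contained_def)
    then obtain U where "U \<in># M" "U \<subseteq> ann {y}" by (auto simp: filter_mset_eq_mempty_iff)
    then show ?thesis
      using line_bound(2)[OF _ assms] that by (auto simp: T_def subset_ann_singleton)
  qed
  then have "s * card T = (\<Sum>y\<in>T. num_contained M (ann {y}))" by simp
  also have "\<dots> = (\<Sum>y\<in>ann {P} - {0}. num_contained M (ann {y}))"
    by (rule sum.mono_neutral_left) (auto simp: T_def)
  also have "\<dots> = 124 + (\<Sum>U\<in>#N. card (ann ({P} \<union> U)) - 1)"
  proof -
    have "insert P L = L" using P(1) by blast
    then show ?thesis
      unfolding sum_num_contained using MN card_ann_line[OF L] by simp
  qed
  also have "(\<Sum>U\<in>#N. card (ann ({P} \<union> U)) - 1) = (\<Sum>U\<in>#N. 24)"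
    by (intro arg_cong[where f = sum_mset] image_mset_cong) (simp add: U)
  finally have *: "s * card T = 124 + 24 * size N" by simp
  \<comment> \<open>Each hyperplane comes from four functionals, so the count
    \<open>124 + 24 * size N\<close> can be divided by 4.\<close>
  have "4 dvd card T"
    using card_scaling_closed[of T] q
    by (simp add: T_def ann_scale mem_ann_singleton dotp_scale vec.scale_eq_0_iff)
  then obtain k where "card T = 4 * k" by blast
  moreover have "size N = 31 * (s - 1)" using assms MN by simp
  ultimately have "s * k = 31 + 186 * (s - 1)" using * by simp
  then show ?thesis by (metis dvd_triv_left)
qed

end

section \<open>Checking explicit systems\<close>

text \<open>The constructors stand for 0, 1, 2, 3, 4 in this order. They make the checks computable
  while the field \<open>'a\<close> stays abstract.\<close>

datatype f5 = Z | A | B | C | D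

fun addf :: "f5 \<Rightarrow> f5 \<Rightarrow> f5" where
  "addf Z y = y" | "addf x Z = x"
| "addf A A = B" | "addf A B = C" | "addf A C = D" | "addf A D = Z"
| "addf B A = C" | "addf B B = D" | "addf B C = Z" | "addf B D = A"
| "addf C A = D" | "addf C B = Z" | "addf C C = A" | "addf C D = B"
| "addf D A = Z" | "addf D B = A" | "addf D C = B" | "addf D D = C"

fun mulf :: "f5 \<Rightarrow> f5 \<Rightarrow> f5" where
  "mulf Z y = Z" | "mulf x Z = Z" | "mulf A y = y" | "mulf x A = x"
| "mulf B B = D" | "mulf B C = A" | "mulf B D = C"
| "mulf C B = A" | "mulf C C = D" | "mulf C D = B"
| "mulf D B = C" | "mulf D C = B" | "mulf D D = A"

fun emb :: "f5 \<Rightarrow> 'a::field" where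
  "emb Z = 0" | "emb A = 1" | "emb B = 2" | "emb C = 3" | "emb D = 4"

text \<open>Adding 1 permutes the field, so the sum of all elements equals itself plus five
  ones.\<close>

lemma five_eq_zero:
  assumes "CARD('a::{field,finite}) = 5"
  shows "(5 :: 'a) = 0"
proof -
  have "(\<Sum>x\<in>UNIV. x + 1) = (\<Sum>x\<in>(UNIV :: 'a set). x)"
    by (rule sum.reindex_bij_betw) (rule bij_betwI[of _ _ _ "\<lambda>x. x - 1"], auto)
  then show ?thesis using assms by (simp add: sum.distrib)
qed

lemma numerals_mod_5:
  assumes "CARD('a::{field,finite}) = 5"
  shows "(5 :: 'a) = 0" "(6 :: 'a) = 1" "(7 :: 'a) = 2" "(8 :: 'a) = 3" "(9 :: 'a) = 4"
    "(12 :: 'a) = 2" "(16 :: 'a) = 1"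
proof -
  note 5 = five_eq_zero[OF assms]
  have "(6 :: 'a) = 5 + 1" "(7 :: 'a) = 5 + 2" "(8 :: 'a) = 5 + 3" "(9 :: 'a) = 5 + 4"
    "(12 :: 'a) = 5 + 5 + 2" "(16 :: 'a) = 5 + 5 + 5 + 1"
    by simp_all
  then show "(5 :: 'a) = 0" "(6 :: 'a) = 1" "(7 :: 'a) = 2" "(8 :: 'a) = 3" "(9 :: 'a) = 4"
    "(12 :: 'a) = 2" "(16 :: 'a) = 1"
    unfolding 5 by simp_all
qed

lemma emb_add:
  assumes "CARD('a::{field,finite}) = 5"
  shows "(emb (addf x y) :: 'a) = emb x + emb y"
  by (cases x; cases y) (simp_all add: numerals_mod_5[OF assms])

lemma emb_mult:
  assumes "CARD('a::{field,finite}) = 5"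
  shows "(emb (mulf x y) :: 'a) = emb x * emb y"
  by (cases x; cases y) (simp_all add: numerals_mod_5[OF assms])

lemma emb_eq_0_iff:
  assumes "CARD('a::{field,finite}) = 5"
  shows "(emb x :: 'a) = 0 \<longleftrightarrow> x = Z"
proof -
  note 5 = five_eq_zero[OF assms]
  have "(2 :: 'a) \<noteq> 0"
  proof
    assume "(2 :: 'a) = 0"
    moreover have "(5 :: 'a) = 2 + 2 + 1" by simp
    ultimately show False using 5 by simp
  qed
  moreover have "(3 :: 'a) \<noteq> 0"
  proof
    assume "(3 :: 'a) = 0"
    moreover have "(5 :: 'a) + 1 = 3 + 3" by simp
    ultimately show False using 5 by simp
  qed
  moreover have "(4 :: 'a) \<noteq> 0"
  proof
    assume "(4 :: 'a) = 0"
    moreover have "(5 :: 'a) = 4 + 1" by simp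
    ultimately show False using 5 by simp
  qed
  ultimately show ?thesis by (cases x) auto
qed

lemma UNIV_f5: "UNIV = {Z, A, B, C, D}"
  using f5.exhaust by auto

lemma surj_emb:
  assumes "CARD('a::{field,finite}) = 5"
  shows "surj (emb :: f5 \<Rightarrow> 'a)"
proof -
  have "inj (emb :: f5 \<Rightarrow> 'a)"
  proof (rule injI)
    fix x y assume *: "(emb x :: 'a) = emb y"
    obtain z where z: "addf x z = Z" by (cases x) (meson addf.simps)+
    then have "(emb (addf y z) :: 'a) = 0"
      using * emb_add[OF assms, of x z] emb_add[OF assms, of y z] by simp
    then have "addf y z = Z" using emb_eq_0_iff[OF assms] by blast
    with z show "x = y" by (cases x; cases z; cases y) simp_all
  qed
  then have "card (range (emb :: f5 \<Rightarrow> 'a)) = 5"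
    by (simp add: card_image UNIV_f5)
  then show ?thesis using assms by (intro card_subset_eq) auto
qed

section \<open>Vectors as lists\<close>

text \<open>Any bijection between the index type and the list positions serves; later arguments rest
  on \<open>bij_idx\<close> alone.\<close>

definition idx :: "5 \<Rightarrow> nat" where
  "idx = (SOME h. bij_betw h UNIV {..<5})"

lemma bij_idx: "bij_betw idx UNIV {..<5}"
proof -
  have "\<exists>h. bij_betw h (UNIV :: 5 set) {..<5 :: nat}"
    by (rule finite_same_card_bij) simp_all
  then show ?thesis unfolding idx_def by (rule someI_ex)
qed

definition vec_of :: "f5 list \<Rightarrow> 'a::field ^ 5" where
  "vec_of l = (\<chi> i. emb (l ! idx i))"

lemma list_length_5:
  assumes "length l = 5"
  obtains a b c d e where "l = [a, b, c, d, e]"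
  using assms by (auto simp: numeral_eq_Suc length_Suc_conv)

lemma vec_of_surj:
  fixes y :: "'a::{field,finite} ^ 5"
  assumes "CARD('a) = 5"
  obtains l where "length l = 5" "y = vec_of l"
proof -
  have "\<forall>x. \<exists>a. (emb a :: 'a) = x" using surj_emb[OF assms] by (metis surjD)
  then obtain f where f: "\<And>x. (emb (f x) :: 'a) = x" by metis
  define l where "l = map (\<lambda>k. f (y $ inv_into UNIV idx k)) [0..<5]"
  have "y $ i = vec_of l $ i" for i
  proof -
    have "idx i < 5" "inv_into UNIV idx (idx i) = i"
      using bij_idx by (auto simp: bij_betw_def)
    then show ?thesis by (simp add: vec_of_def l_def f)
  qed
  then have "y = vec_of l" unfolding vec_eq_iff by blast
  moreover have "length l = 5" by (simp add: l_def)
  ultimately show ?thesis using that by blast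
qed

section \<open>Traversal of all hyperplanes\<close>

text \<open>The values of a functional on both generators of a line are accumulated together, one
  column at a time; the line lies in the hyperplane iff the result is \<open>(Z, Z)\<close>.\<close>

fun eval_at :: "f5 \<times> f5 \<Rightarrow> (f5 \<times> f5) list \<Rightarrow> f5 list \<Rightarrow> f5 \<times> f5" where
  "eval_at (p, q) ((u, v) # cs) (y # ys) = eval_at (addf p (mulf y u), addf q (mulf y v)) cs ys"
| "eval_at pq _ _ = pq"

lemma sum_idx: "(\<Sum>i\<in>UNIV. F (idx i)) = (\<Sum>k<5. F k)"
  by (rule sum.reindex_bij_betw[OF bij_idx])

lemma eval_at_dotp:
  assumes q: "CARD('a::{field,finite}) = 5" and "length y = 5" "length u = 5" "length v = 5"
  shows "eval_at (Z, Z) (zip u v) y = (Z, Z) \<longleftrightarrow>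
    dotp (vec_of y :: 'a ^ 5) (vec_of u) = 0 \<and> dotp (vec_of y :: 'a ^ 5) (vec_of v) = 0"
proof -
  obtain y1 y2 y3 y4 y5 where y: "y = [y1, y2, y3, y4, y5]" using assms(2) by (rule list_length_5)
  obtain u1 u2 u3 u4 u5 where u: "u = [u1, u2, u3, u4, u5]" using assms(3) by (rule list_length_5)
  obtain v1 v2 v3 v4 v5 where v: "v = [v1, v2, v3, v4, v5]" using assms(4) by (rule list_length_5)
  have dot: "dotp (vec_of y :: 'a ^ 5) (vec_of w) = (\<Sum>k<5. emb (y ! k) * emb (w ! k))" for w
    using sum_idx[of "\<lambda>k. emb (y ! k) * emb (w ! k) :: 'a"] by (simp add: dotp_def vec_of_def)
  show ?thesis
    unfolding dot unfolding y u v
    by (simp add: eval_nat_numeral emb_eq_0_iff[OF q, symmetric] emb_add[OF q] emb_mult[OF q])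
qed

text \<open>A line once some coordinates of the functional are fixed: its two partial sums and the
  columns still to be read.\<close>

type_synonym state = "(f5 \<times> f5) \<times> (f5 \<times> f5) list"

definition hits :: "f5 list \<Rightarrow> state list \<Rightarrow> nat" where
  "hits ys st = length (filter (\<lambda>(pq, cs). eval_at pq cs ys = (Z, Z)) st)"

fun adv :: "f5 \<Rightarrow> state list \<Rightarrow> state list" where
  "adv y [] = []"
| "adv y (((p, q), (u, v) # cs) # st) = ((addf p (mulf y u), addf q (mulf y v)), cs) # adv y st"
| "adv y ((pq, []) # st) = adv y st"

text \<open>With one coordinate left, both partial sums can only vanish if they are proportional to the
  remaining column.\<close>

fun alive :: "state list \<Rightarrow> state list" where
  "alive [] = []"
| "alive (((p, q), (u, v) # cs) # st) =
    (if mulf p v = mulf q u then ((p, q), (u, v) # cs) # alive st else alive st)"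
| "alive ((pq, []) # st) = alive st"

fun count_zero :: "state list \<Rightarrow> nat" where
  "count_zero [] = 0"
| "count_zero (((Z, Z), cs) # st) = Suc (count_zero st)"
| "count_zero ((pq, cs) # st) = count_zero st"

text \<open>Depth-first search over the remaining \<open>k\<close> coordinates, so that functionals
  with a common prefix share partial sums. \<open>acc\<close> holds the fixed coordinates in reverse
  and lets the bound depend on the functional; \<open>alive\<close> prunes when one coordinate is
  left.\<close>

fun chk :: "(f5 list \<Rightarrow> nat) \<Rightarrow> f5 list \<Rightarrow> nat \<Rightarrow> state list \<Rightarrow> bool" where
  "chk b acc 0 st \<longleftrightarrow> count_zero st \<le> b acc"
| "chk b acc (Suc k) st \<longleftrightarrow> (let st' = if k = 0 then alive st else st in
     chk b (Z # acc) k (adv Z st') \<and> chk b (A # acc) k (adv A st') \<and> chk b (B # acc) k (adv B st') \<and>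
     chk b (C # acc) k (adv C st') \<and> chk b (D # acc) k (adv D st'))"

text \<open>Visits only functionals whose first nonzero coordinate is 1: one for each of the 781
  hyperplanes.\<close>

fun chk_proj :: "(f5 list \<Rightarrow> nat) \<Rightarrow> f5 list \<Rightarrow> nat \<Rightarrow> state list \<Rightarrow> bool" where
  "chk_proj b acc 0 st \<longleftrightarrow> True"
| "chk_proj b acc (Suc k) st \<longleftrightarrow> chk_proj b (Z # acc) k (adv Z st) \<and> chk b (A # acc) k (adv A st)"

definition well_formed :: "nat \<Rightarrow> state list \<Rightarrow> bool" where
  "well_formed k st \<longleftrightarrow> (\<forall>(pq, cs)\<in>set st. length cs = k)"

lemma hits_adv: "well_formed (Suc k) st \<Longrightarrow> hits (y # ys) st = hits ys (adv y st)"
  by (induction y st rule: adv.induct) (auto simp: hits_def well_formed_def)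

lemma well_formed_adv: "well_formed (Suc k) st \<Longrightarrow> well_formed k (adv y st)"
  by (induction y st rule: adv.induct) (auto simp: well_formed_def)

text \<open>\<open>D\<close> stands for 4 = -1, so \<open>mulf D\<close> is negation.\<close>

lemma addf_eq_Z: "addf x y = Z \<Longrightarrow> x = mulf D y"
  by (cases x; cases y) simp_all

lemma mulf_Z: "mulf x Z = Z"
  by (cases x) simp_all

lemma mulf_neg_swap: "mulf (mulf D (mulf y u)) v = mulf (mulf D (mulf y v)) u"
  by (cases y; cases u; cases v) simp_all

lemma hits_alive: "well_formed (Suc 0) st \<Longrightarrow> hits [y] (alive st) = hits [y] st"
proof (induction st rule: alive.induct)
  case (2 p q u v cs st)
  have "mulf p v = mulf q u" if "addf p (mulf y u) = Z" "addf q (mulf y v) = Z"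
    using that[THEN addf_eq_Z] mulf_neg_swap by metis
  then show ?case using 2 by (auto simp: hits_def well_formed_def)
qed (auto simp: hits_def well_formed_def)

lemma well_formed_alive: "well_formed k st \<Longrightarrow> well_formed k (alive st)"
  by (induction st rule: alive.induct) (auto simp: well_formed_def)

lemma hits_Nil: "hits [] st = count_zero st"
  by (induction st rule: count_zero.induct) (auto simp: hits_def)

lemma chk_sound:
  assumes "chk b acc k st" "length ys = k" "well_formed k st"
  shows "hits ys st \<le> b (rev ys @ acc)"
  using assms
proof (induction k arbitrary: acc st ys)
  case 0
  then show ?case by (simp add: hits_Nil)
next
  case (Suc k)
  then obtain y zs where ys: "ys = y # zs" "length zs = k" by (cases ys) auto
  define st' where "st' = (if k = 0 then alive st else st)"
  have wf: "well_formed (Suc k) st'"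
    using Suc.prems(3) well_formed_alive[of "Suc k" st] by (auto simp: st'_def)
  have "chk b (y # acc) k (adv y st')"
    using Suc.prems(1) by (cases y) (simp_all add: st'_def Let_def)
  then have "hits zs (adv y st') \<le> b (rev zs @ y # acc)"
    by (rule Suc.IH[OF _ ys(2) well_formed_adv[OF wf]])
  moreover have "hits ys st = hits ys st'"
    using Suc.prems(3) ys by (auto simp: st'_def hits_alive)
  ultimately show ?case using hits_adv[OF wf] ys(1) by simp
qed

lemma chk_proj_sound:
  assumes "chk_proj b acc k st" "length ys = k" "well_formed k st" "ys = replicate i Z @ A # r"
  shows "hits ys st \<le> b (rev ys @ acc)"
  using assms
proof (induction i arbitrary: k acc st ys)
  case 0
  then obtain k' where "k = Suc k'" "length r = k'" by (cases k) auto
  then show ?case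
    using 0 chk_sound[of b "A # acc" k' "adv A st" r] hits_adv well_formed_adv by simp
next
  case (Suc i)
  then obtain k' where "k = Suc k'" "length (replicate i Z @ A # r) = k'" by (cases k) auto
  then show ?case
    using Suc.prems Suc.IH[of "Z # acc" k' "adv Z st" "replicate i Z @ A # r"] hits_adv well_formed_adv
    by simp
qed

text \<open>The hyperplanes \<open>ann {y}\<close> with \<open>special y\<close> are the six that contain the plane \<open>x\<^sub>1 = x\<^sub>2 = 0\<close>.\<close>

definition special :: "'a::field ^ 5 \<Rightarrow> bool" where
  "special y \<longleftrightarrow> (\<forall>i. 2 \<le> idx i \<longrightarrow> y $ i = 0)"

text \<open>Two bounds, \<open>h\<close> on the special hyperplanes and \<open>g\<close> on the
  others, so that blocks crowding the special hyperplanes can be added to blocks leaving them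
  empty.\<close>

definition has_system :: "'a::{field,finite} itself \<Rightarrow> nat \<Rightarrow> nat \<Rightarrow> nat \<Rightarrow> bool" where
  "has_system _ n g h \<longleftrightarrow> (\<exists>M :: ('a ^ 5) set multiset. size M = n \<and>
     (\<forall>U\<in>#M. vec.subspace U \<and> vec.dim U \<le> 2) \<and>
     (\<forall>y. y \<noteq> 0 \<longrightarrow> num_contained M (ann {y}) \<le> (if special y then h else g)))"

text \<open>The list arrives reversed: the pattern tests the last three coordinates.\<close>

fun bnd :: "nat \<Rightarrow> nat \<Rightarrow> f5 list \<Rightarrow> nat" where
  "bnd g h (Z # Z # Z # _) = h"
| "bnd g h _ = g"

definition check :: "nat \<Rightarrow> nat \<Rightarrow> nat \<Rightarrow> (f5 list \<times> f5 list) list \<Rightarrow> bool" where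
  "check n g h ls \<longleftrightarrow> length ls = n \<and> list_all (\<lambda>(u, v). length u = 5 \<and> length v = 5) ls \<and>
     chk_proj (bnd g h) [] 5 (map (\<lambda>(u, v). ((Z, Z), zip u v)) ls)"

lemma ex_normalized:
  fixes y :: "'a::{field,finite} ^ 5"
  assumes q: "CARD('a) = 5" and "y \<noteq> 0"
  obtains ys i r c where "length ys = 5" "ys = replicate i Z @ A # r" "c \<noteq> 0" "vec_of ys = c *s y"
proof -
  obtain l where l: "length l = 5" "y = vec_of l" using vec_of_surj[OF q] by blast
  have "\<exists>x\<in>set l. x \<noteq> Z"
  proof (rule ccontr)
    assume "\<not> (\<exists>x\<in>set l. x \<noteq> Z)"
    then have "l ! idx i = Z" for i
      using l(1) bij_idx by (metis bij_betw_apply iso_tuple_UNIV_I lessThan_iff nth_mem)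
    then have "y = 0" unfolding l(2) vec_of_def by (simp add: vec_eq_iff)
    with assms(2) show False by simp
  qed
  then obtain pre x r where pre: "l = pre @ x # r" "x \<noteq> Z" "\<forall>z\<in>set pre. z = Z"
    using split_list_first_prop[of l "\<lambda>x. x \<noteq> Z"] by blast
  \<comment> \<open>\<open>d\<close> is the inverse of \<open>x\<close>: 2 and 3 are inverse to each
    other, 1 and 4 to themselves.\<close>
  obtain d where d: "mulf d x = A" "d \<noteq> Z"
  proof (cases x)
    case A then show ?thesis using that[of A] by simp
  next
    case B then show ?thesis using that[of C] by simp
  next
    case C then show ?thesis using that[of B] by simp
  next
    case D then show ?thesis using that[of D] by simp
  qed (use pre(2) in simp)
  define ys where "ys = map (mulf d) l"
  have "map (mulf d) pre = replicate (length pre) Z"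
    using pre(3) by (induction pre) (auto simp: mulf_Z)
  then have "ys = replicate (length pre) Z @ A # map (mulf d) r"
    using pre(1) d(1) by (simp add: ys_def)
  moreover have "vec_of ys $ i = (emb d *s y) $ i" for i
  proof -
    have "idx i < length l" using bij_idx l(1) by (auto simp: bij_betw_def)
    then show ?thesis unfolding l(2) by (simp add: vec_of_def ys_def emb_mult[OF q])
  qed
  then have "vec_of ys = emb d *s y" by (simp add: vec_eq_iff)
  moreover have "(emb d :: 'a) \<noteq> 0" using d(2) emb_eq_0_iff[OF q] by blast
  moreover have "length ys = 5" using l(1) by (simp add: ys_def)
  ultimately show ?thesis using that by blast
qed

lemma special_bnd:
  assumes "CARD('a::{field,finite}) = 5" "length ys = 5"
  shows "bnd g h (rev ys) = (if special (vec_of ys :: 'a ^ 5) then h else g)"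
proof -
  obtain a b c d e where ys: "ys = [a, b, c, d, e]" using assms(2) by (rule list_length_5)
  have "special (vec_of ys :: 'a ^ 5) \<longleftrightarrow> (\<forall>k<5. 2 \<le> k \<longrightarrow> ys ! k = Z)"
  proof -
    have "(\<forall>i. 2 \<le> idx i \<longrightarrow> ys ! idx i = Z) \<longleftrightarrow> (\<forall>k\<in>range idx. 2 \<le> k \<longrightarrow> ys ! k = Z)" by simp
    also have "range idx = {..<5}" using bij_idx by (simp add: bij_betw_def)
    finally show ?thesis
      by (auto simp: special_def vec_of_def emb_eq_0_iff[OF assms(1)])
  qed
  also have "\<dots> \<longleftrightarrow> c = Z \<and> d = Z \<and> e = Z"
    unfolding ys by (auto simp: eval_nat_numeral less_Suc_eq)
  finally show ?thesis unfolding ys by (cases c; cases d; cases e) simp_all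
qed

text \<open>Every nonzero functional is proportional to a normalized list and \<open>ann {y}\<close>
  is invariant under scaling, so the finite traversal bounds all hyperplanes.\<close>

theorem has_systemI:
  assumes q: "CARD('a::{field,finite}) = 5" and chk: "check n g h ls"
  shows "has_system TYPE('a) n g h"
proof -
  define ln :: "f5 list \<times> f5 list \<Rightarrow> ('a ^ 5) set" where
    "ln = (\<lambda>(u, v). vec.span {vec_of u, vec_of v})"
  define M where "M = mset (map ln ls)"
  define st where "st = map (\<lambda>(u, v). ((Z, Z), zip u v)) ls"
  have len: "length u = 5 \<and> length v = 5" if "(u, v) \<in> set ls" for u v
    using chk that by (auto simp: check_def list_all_iff)
  have num: "num_contained M (ann {vec_of ys}) = hits ys st" if "length ys = 5" for ys
  proof -
    have "ln (u, v) \<subseteq> ann {vec_of ys} \<longleftrightarrow> eval_at (Z, Z) (zip u v) ys = (Z, Z)"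
      if "(u, v) \<in> set ls" for u v
    proof -
      have "ln (u, v) \<subseteq> ann {vec_of ys} \<longleftrightarrow> (vec_of ys :: 'a ^ 5) \<in> ann {vec_of u, vec_of v}"
        by (simp add: ln_def subset_ann_singleton ann_span)
      then show ?thesis
        using eval_at_dotp[OF q \<open>length ys = 5\<close>] len[OF that] by (simp add: ann_def)
    qed
    then have "filter (\<lambda>uv. ln uv \<subseteq> ann {vec_of ys}) ls =
        filter (\<lambda>(u, v). eval_at (Z, Z) (zip u v) ys = (Z, Z)) ls"
      by (intro filter_cong) auto
    moreover have "num_contained M (ann {vec_of ys}) =
        length (filter (\<lambda>U. U \<subseteq> ann {vec_of ys}) (map ln ls))"
      unfolding num_contained_def M_def mset_filter[symmetric] size_mset ..
    ultimately show ?thesis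
      by (simp add: hits_def st_def filter_map comp_def case_prod_unfold)
  qed
  have bound: "num_contained M (ann {y}) \<le> (if special y then h else g)" if y: "y \<noteq> 0" for y
  proof -
    obtain ys i r c where ys: "length ys = 5" "ys = replicate i Z @ A # r" and c: "c \<noteq> 0" "vec_of ys = c *s y"
      using ex_normalized[OF q y] by blast
    have "well_formed 5 st" using len by (auto simp: well_formed_def st_def)
    then have "hits ys st \<le> bnd g h (rev ys)"
      using chk_proj_sound[of "bnd g h" "[]" 5 st ys i r] chk ys by (simp add: check_def st_def)
    moreover have "special (c *s y) \<longleftrightarrow> special y" using c(1) by (simp add: special_def)
    ultimately show ?thesis
      using num[OF ys(1)] special_bnd[OF q ys(1), of g h] ann_scale[OF c(1), of y] by (simp add: c(2))
  qed
  have size: "size M = n" using chk by (simp add: M_def check_def)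
  have sub: "vec.subspace U \<and> vec.dim U \<le> 2" if "U \<in># M" for U
  proof -
    from that obtain u v where U: "U = vec.span {vec_of u, vec_of v}" by (auto simp: M_def ln_def)
    have "vec.dim U \<le> card {vec_of u, vec_of v :: 'a ^ 5}"
      unfolding U by (rule vec.dim_le_card) auto
    also have "\<dots> \<le> 2" by (simp add: card_insert_if)
    finally show ?thesis using U by simp
  qed
  show ?thesis
    unfolding has_system_def
    by (intro exI[of _ M] conjI ballI allI impI size bound) (simp_all add: sub)
qed

section \<open>Addition of systems\<close>

lemma num_contained_add: "num_contained (M + N) H = num_contained M H + num_contained N H"
  by (simp add: num_contained_sum)

lemma num_contained_replicate_zero: "0 \<in> H \<Longrightarrow> num_contained (replicate_mset k {0}) H = k"
  by (induction k) (simp_all add: num_contained_sum)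

lemma has_system_add:
  assumes "has_system TYPE('a::{field,finite}) n g h" "has_system TYPE('a) n' g' h'"
  shows "has_system TYPE('a) (n + n') (g + g') (h + h')"
proof -
  obtain M where M: "size M = n" "\<forall>U\<in>#M. vec.subspace U \<and> vec.dim U \<le> 2"
    "\<forall>y :: 'a ^ 5. y \<noteq> 0 \<longrightarrow> num_contained M (ann {y}) \<le> (if special y then h else g)"
    using assms(1) unfolding has_system_def by (elim exE conjE) (rule that; assumption)
  obtain M' where M': "size M' = n'" "\<forall>U\<in>#M'. vec.subspace U \<and> vec.dim U \<le> 2"
    "\<forall>y :: 'a ^ 5. y \<noteq> 0 \<longrightarrow> num_contained M' (ann {y}) \<le> (if special y then h' else g')"
    using assms(2) unfolding has_system_def by (elim exE conjE) (rule that; assumption)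
  have "num_contained (M + M') (ann {y}) \<le> (if special y then h + h' else g + g')" if "y \<noteq> 0" for y :: "'a ^ 5"
    using M(3)[rule_format, OF that] M'(3)[rule_format, OF that]
    by (auto simp: num_contained_add split: if_splits)
  moreover have "\<forall>U\<in>#M + M'. vec.subspace U \<and> vec.dim U \<le> 2" using M(2) M'(2) by auto
  ultimately show ?thesis
    unfolding has_system_def using M(1) M'(1) by (intro exI[of _ "M + M'"]) simp
qed

lemma has_system_mono:
  assumes "has_system TYPE('a::{field,finite}) n g h" "g \<le> g'" "h \<le> h'"
  shows "has_system TYPE('a) n g' h'"
proof -
  obtain M where M: "size M = n" "\<forall>U\<in>#M. vec.subspace U \<and> vec.dim U \<le> 2"
    "\<forall>y :: 'a ^ 5. y \<noteq> 0 \<longrightarrow> num_contained M (ann {y}) \<le> (if special y then h else g)"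
    using assms(1) unfolding has_system_def by (elim exE conjE) (rule that; assumption)
  have "num_contained M (ann {y}) \<le> (if special y then h' else g')" if "y \<noteq> 0" for y :: "'a ^ 5"
    using M(3)[rule_format, OF that] assms(2,3) by (simp split: if_splits)
  then show ?thesis
    unfolding has_system_def using M(1,2) by (intro exI[of _ M]) simp
qed

lemma has_system_combine:
  assumes "has_system TYPE('a::{field,finite}) n g h" "has_system TYPE('a) n' g' h'"
    "n + n' = N" "g + g' \<le> G" "h + h' \<le> H"
  shows "has_system TYPE('a) N G H"
  using has_system_mono[OF has_system_add[OF assms(1,2)] assms(4,5)] assms(3) by simp

lemma size_le_if_projective_system:
  fixes M :: "('a::{field,finite} ^ 5) set multiset"
  assumes "CARD('a) = 5" "projective_system 2 n s M"
  shows "(n - s + 4) div 5 + (n - s + 24) div 25 + (n - s + 124) div 125 \<le> 6 * s"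
    and "n \<le> 31 * (s - 1) + 1"
    and "n = 31 * (s - 1) + 1 \<Longrightarrow> s dvd 31 + 186 * (s - 1)"
proof -
  obtain M' :: "('a ^ 5) set multiset" where M': "size M' = n" "line_system M' s"
    using projective_system_imp_line_system[OF assms(2)] by auto
  show "(n - s + 4) div 5 + (n - s + 24) div 25 + (n - s + 124) div 125 \<le> 6 * s"
    using griesmer[OF assms(1) M'(2)] M'(1) by simp
  show "n \<le> 31 * (s - 1) + 1"
  proof (cases "M' = {#}")
    case False
    then obtain L where "L \<in># M'" by blast
    then show ?thesis using line_bound(1)[OF assms(1) M'(2)] M'(1) by blast
  qed (use M'(1) in simp)
  show "s dvd 31 + 186 * (s - 1)" if "n = 31 * (s - 1) + 1"
    using line_bound_eq[OF assms(1) M'(2)] M'(1) that by simp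
qed

section \<open>Explicit systems\<close>

text \<open>Row vector times matrix. The default is the empty sum; \<open>map2\<close> cuts its five
  zeros to the row length, so the 3 by 3 matrix in \<open>mrd_lines\<close> is covered too.\<close>

fun vm :: "f5 list \<Rightarrow> f5 list list \<Rightarrow> f5 list" where
  "vm (c # cs) (r # rs) = map2 addf (map (mulf c) r) (vm cs rs)"
| "vm _ _ = [Z, Z, Z, Z, Z]"

text \<open>Images under the powers of \<open>m\<close> with exponents 0 to \<open>k - 1\<close>,
  repetitions included.\<close>

fun orb :: "f5 list list \<Rightarrow> nat \<Rightarrow> (f5 list \<times> f5 list) list \<Rightarrow> (f5 list \<times> f5 list) list" where
  "orb m 0 ls = []"
| "orb m (Suc k) ls = ls @ orb m k (map (\<lambda>(u, v). (vm u m, vm v m)) ls)"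

definition scalars :: "f5 list" where
  "scalars = [Z, A, B, C, D]"

text \<open>The matrix has the irreducible characteristic polynomial \<open>x\<^sup>3 + x + 1\<close>, so these 125 lines form a
  lifted MRD code: they partition the points off the plane \<open>x\<^sub>1 = x\<^sub>2 = 0\<close>.\<close>

definition mrd_lines :: "(f5 list \<times> f5 list) list" where
  "mrd_lines = [([A, Z, a, b, c], [Z, A] @ vm [a, b, c] [[Z, A, Z], [Z, Z, A], [D, D, Z]]).
     a \<leftarrow> scalars, b \<leftarrow> scalars, c \<leftarrow> scalars]"

text \<open>All 31 lines of the plane, in echelon form. A hyperplane not containing the plane meets
  it in one line, so any \<open>m\<close> of them have bounds 1 and \<open>m\<close>.\<close>

definition plane_lines :: "(f5 list \<times> f5 list) list" where
  "plane_lines = [([Z, Z, A, Z, a], [Z, Z, Z, A, b]). a \<leftarrow> scalars, b \<leftarrow> scalars] @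
     [([Z, Z, A, a, Z], [Z, Z, Z, Z, A]). a \<leftarrow> scalars] @ [([Z, Z, Z, A, Z], [Z, Z, Z, Z, A])]"

text \<open>A Desarguesian spread of the solid spanned by \<open>(d, 0)\<close> and the plane \<open>x\<^sub>1 = x\<^sub>2 = 0\<close>, built from
  \<open>\<F>\<^sub>5(\<surd>2)\<close>; its last line is the one inside that plane.\<close>

definition spread_lines :: "f5 \<times> f5 \<Rightarrow> (f5 list \<times> f5 list) list" where
  "spread_lines d = [([fst d, snd d, Z, a, b], [Z, Z, A, mulf B b, a]). a \<leftarrow> scalars, b \<leftarrow> scalars] @
     [([Z, Z, Z, A, Z], [Z, Z, Z, Z, A])]"

text \<open>Uses \<open>y\<close> of the six solids and \<open>f\<close> lines in each. For
  \<open>f = 26\<close> the line inside the plane occurs \<open>y\<close> times, so a special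
  hyperplane holds up to \<open>25 + y\<close> lines; for \<open>f < 26\<close> that line is left
  out and the bound is \<open>f\<close>.\<close>

definition spreads :: "nat \<Rightarrow> nat \<Rightarrow> (f5 list \<times> f5 list) list" where
  "spreads y f = concat (map (\<lambda>d. take f (spread_lines d))
     (take y [(Z, A), (A, Z), (A, A), (A, B), (A, C), (A, D)]))"

section \<open>The values\<close>

context
  assumes q: "CARD('a::{field,finite}) = 5"
begin

section \<open>From systems and bounds to the maximum\<close>

lemma finite_system_sizes:
  "finite {n. \<exists>M :: ('a ^ 5) set multiset. projective_system 2 n s M}"
  by (rule finite_subset[of _ "{..31 * (s - 1) + 1}"]) (use size_le_if_projective_system(2)[OF q] in auto)

text \<open>A projective system must attain \<open>s\<close>. Zero subspaces lie in every
  hyperplane, so \<open>s - Max K\<close> copies lift the actual maximum to \<open>s\<close> and can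
  only increase the size.\<close>

lemma max_system_size_geI:
  assumes "has_system TYPE('a) n s s" "m \<le> n"
  shows "m \<le> max_system_size TYPE('a ^ 5) 2 s"
proof -
  obtain M where M: "size M = n" "\<forall>U\<in>#M. vec.subspace U \<and> vec.dim U \<le> 2"
    "\<forall>y :: 'a ^ 5. y \<noteq> 0 \<longrightarrow> num_contained M (ann {y}) \<le> s"
    using assms(1) unfolding has_system_def by auto
  have hyp: "num_contained M H \<le> s" if H: "hyperplane H" for H
  proof -
    obtain y where y: "y \<noteq> 0" "H \<subseteq> ann {y}" using hyperplane_subset_ann[OF H] by blast
    have "num_contained M H \<le> num_contained M (ann {y})"
      unfolding num_contained_sum using y(2) by (intro sum_mset_mono) auto
    then show ?thesis using M(3) y(1) le_trans by blast
  qed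
  define K where "K = num_contained M ` {H. hyperplane H}"
  have "axis 0 1 \<noteq> (0 :: 'a ^ 5)" by (simp add: axis_eq_0_iff)
  then have "K \<noteq> {}" using hyperplane_ann unfolding K_def by blast
  then have "Max K \<in> K" by (intro Max_in) (auto simp: K_def)
  then obtain H where H: "hyperplane H" "num_contained M H = Max K" by (auto simp: K_def)
  have le: "num_contained M H' \<le> Max K" if "hyperplane H'" for H'
    using that by (intro Max_ge) (auto simp: K_def)
  have "Max K \<le> s" using hyp H by metis
  define N where "N = M + replicate_mset (s - Max K) {0}"
  have num: "num_contained N H' = num_contained M H' + (s - Max K)" if "hyperplane H'" for H'
  proof -
    have "0 \<in> H'" using that vec.subspace_0 by (auto simp: hyperplane_def)
    then show ?thesis by (simp add: N_def num_contained_replicate_zero num_contained_add)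
  qed
  have "projective_system 2 (n + (s - Max K)) s N"
    unfolding projective_system_def
  proof (intro conjI)
    show "size N = n + (s - Max K)" using M(1) by (simp add: N_def)
    show "\<forall>U\<in>#N. vec.subspace U \<and> vec.dim U \<le> 2"
      using M(2) by (auto simp: N_def vec.subspace_single_0)
    show "\<forall>H. hyperplane H \<longrightarrow> num_contained N H \<le> s"
      using num le \<open>Max K \<le> s\<close> by fastforce
    show "\<exists>H. hyperplane H \<and> num_contained N H = s"
      using num[OF H(1)] H \<open>Max K \<le> s\<close> by (intro exI[of _ H]) simp
  qed
  then have "n + (s - Max K) \<le> max_system_size TYPE('a ^ 5) 2 s"
    unfolding max_system_size_def by (intro Max_ge finite_system_sizes) blast
  then show ?thesis using assms(2) by simp
qed

lemma max_system_size_in: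
  "\<exists>M :: ('a ^ 5) set multiset. projective_system 2 (max_system_size TYPE('a ^ 5) 2 s) s M"
proof -
  have "vec.dim {0 :: 'a ^ 5} \<le> 2" by simp
  have "axis 0 1 \<noteq> (0 :: 'a ^ 5)" by (simp add: axis_eq_0_iff)
  then obtain H :: "('a ^ 5) set" where H: "hyperplane H" using hyperplane_ann by blast
  have "num_contained (replicate_mset s {0}) H' = s" if "hyperplane H'" for H' :: "('a ^ 5) set"
  proof -
    have "0 \<in> H'" using that vec.subspace_0 by (auto simp: hyperplane_def)
    then show ?thesis by (simp add: num_contained_replicate_zero)
  qed
  then have "projective_system 2 s s (replicate_mset s {0 :: 'a ^ 5})"
    unfolding projective_system_def using H by (auto simp: vec.subspace_single_0)
  then have "{n. \<exists>M :: ('a ^ 5) set multiset. projective_system 2 n s M} \<noteq> {}" by blast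
  from Max_in[OF finite_system_sizes this] show ?thesis
    unfolding max_system_size_def by simp
qed

text \<open>The left side of the Griesmer inequality grows with the size, so failure at
  \<open>b + 1\<close> excludes all larger sizes.\<close>

lemma max_system_size_le_griesmer:
  assumes "6 * s < (b + 1 - s + 4) div 5 + (b + 1 - s + 24) div 25 + (b + 1 - s + 124) div 125"
  shows "max_system_size TYPE('a ^ 5) 2 s \<le> b"
proof (rule ccontr)
  let ?n = "max_system_size TYPE('a ^ 5) 2 s"
  assume "\<not> ?n \<le> b"
  then have *: "b + 1 - s \<le> ?n - s" by simp
  have "(b + 1 - s + 4) div 5 + (b + 1 - s + 24) div 25 + (b + 1 - s + 124) div 125
      \<le> (?n - s + 4) div 5 + (?n - s + 24) div 25 + (?n - s + 124) div 125"
    by (intro add_mono div_le_mono *) simp_all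
  also have "\<dots> \<le> 6 * s"
    using max_system_size_in size_le_if_projective_system(1)[OF q] by blast
  finally show False using assms by linarith
qed

lemma max_system_size_le_lines:
  assumes "\<not> s dvd 31 + 186 * (s - 1)"
  shows "max_system_size TYPE('a ^ 5) 2 s \<le> 31 * (s - 1)"
proof -
  obtain M :: "('a ^ 5) set multiset" where M: "projective_system 2 (max_system_size TYPE('a ^ 5) 2 s) s M"
    using max_system_size_in by blast
  show ?thesis
    using size_le_if_projective_system(2,3)[OF q M] assms by linarith
qed

section \<open>Building blocks\<close>

lemma system_mrd: "has_system TYPE('a) 125 5 0"
  by (rule has_systemI[OF q, of _ _ _ "mrd_lines"]) code_simp

lemma system_plane_11: "has_system TYPE('a) 11 1 11"
  by (rule has_systemI[OF q, of _ _ _ "take 11 plane_lines"]) code_simp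

lemma system_plane_16: "has_system TYPE('a) 16 1 16"
  by (rule has_systemI[OF q, of _ _ _ "take 16 plane_lines"]) code_simp

lemma system_plane_21: "has_system TYPE('a) 21 1 21"
  by (rule has_systemI[OF q, of _ _ _ "take 21 plane_lines"]) code_simp

lemma system_spreads_1: "has_system TYPE('a) 26 1 26"
  by (rule has_systemI[OF q, of _ _ _ "spreads 1 26"]) code_simp

lemma system_spreads_2: "has_system TYPE('a) 52 2 27"
  by (rule has_systemI[OF q, of _ _ _ "spreads 2 26"]) code_simp

lemma system_spreads_3: "has_system TYPE('a) 78 3 28"
  by (rule has_systemI[OF q, of _ _ _ "spreads 3 26"]) code_simp

lemma system_spreads_4: "has_system TYPE('a) 104 4 29"
  by (rule has_systemI[OF q, of _ _ _ "spreads 4 26"]) code_simp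

lemma system_spreads_5: "has_system TYPE('a) 130 5 30"
  by (rule has_systemI[OF q, of _ _ _ "spreads 5 26"]) code_simp

lemma system_spreads_6: "has_system TYPE('a) 156 6 31"
  by (rule has_systemI[OF q, of _ _ _ "spreads 6 26"]) code_simp

text \<open>The number of lines per solid is the target \<open>s = 22\<close>: four MRD codes add 20
  elsewhere and nothing on the special hyperplanes. The next two blocks follow the same
  pattern.\<close>

lemma system_partial_spreads_2: "has_system TYPE('a) 44 2 22"
  by (rule has_systemI[OF q, of _ _ _ "spreads 2 22"]) code_simp

lemma system_partial_spreads_3: "has_system TYPE('a) 69 3 23"
  by (rule has_systemI[OF q, of _ _ _ "spreads 3 23"]) code_simp

lemma system_partial_spreads_4: "has_system TYPE('a) 96 4 24"
  by (rule has_systemI[OF q, of _ _ _ "spreads 4 24"]) code_simp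

text \<open>The matrix has order 8 and fixes the last line listed; 27 = 3 * 8 + 2 + 1.\<close>

lemma system_2: "has_system TYPE('a) 27 2 2"
proof (rule has_systemI[OF q])
  show "check 27 2 2
    (let gen = [[A, Z, Z, Z, Z], [Z, A, Z, Z, Z], [Z, Z, B, Z, Z], [Z, Z, Z, Z, A], [Z, Z, Z, B, Z]] in
     orb gen 8
      [([Z, A, Z, A, A], [A, Z, B, D, B]),
       ([Z, A, A, Z, A], [A, Z, B, D, Z]),
       ([Z, A, A, B, D], [A, Z, C, A, D])] @
     orb gen 2
      [([Z, Z, Z, A, A], [Z, Z, A, Z, Z])] @
     [([Z, A, Z, Z, Z], [A, Z, Z, Z, Z])])"
    by code_simp
qed

lemma system_3: "has_system TYPE('a) 51 3 3"
proof (rule has_systemI[OF q])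
  show "check 51 3 3
    (let gen = [[A, C, Z, Z, B], [D, D, C, D, D], [Z, Z, D, C, D], [Z, Z, D, B, B], [Z, Z, Z, Z, B]] in
     orb gen 24
      [([Z, A, Z, Z, Z], [A, Z, A, B, Z]),
       ([Z, A, Z, Z, B], [A, Z, A, Z, C])] @
     orb gen 2
      [([Z, Z, Z, Z, A], [Z, A, D, Z, Z])] @
     [([Z, A, D, Z, C], [A, Z, B, D, A])])"
    by code_simp
qed

lemma system_4: "has_system TYPE('a) 77 4 4"
proof (rule has_systemI[OF q])
  show "check 77 4 4
    (let gen = [[A, Z, Z, Z, Z], [Z, A, Z, Z, Z], [Z, Z, B, Z, Z], [Z, Z, A, A, A], [Z, Z, Z, C, B]] in
     orb gen 12
      [([Z, A, Z, Z, A], [A, Z, C, C, A]),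
       ([Z, A, Z, A, B], [A, Z, A, B, A]),
       ([Z, A, Z, A, C], [A, Z, D, C, B]),
       ([Z, A, A, Z, A], [A, Z, D, C, A]),
       ([Z, A, A, Z, D], [A, Z, Z, C, A]),
       ([Z, A, A, A, Z], [A, Z, A, C, B])] @
     [([Z, Z, Z, A, Z], [Z, Z, A, Z, A]),
       ([Z, Z, A, Z, Z], [A, Z, Z, Z, Z]),
       ([Z, Z, A, Z, Z], [A, A, Z, Z, Z]),
       ([Z, Z, A, Z, Z], [A, B, Z, Z, Z]),
       ([Z, Z, A, Z, Z], [A, C, Z, Z, Z])])"
    by code_simp
qed

text \<open>The matrix has order 11 and acts irreducibly, so it lies in a Singer cycle; twelve
  orbits of length 11 give 132 lines.\<close>

lemma system_6: "has_system TYPE('a) 132 6 6"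
proof (rule has_systemI[OF q])
  show "check 132 6 6
    (let gen = [[Z, A, C, C, B], [D, B, A, C, C], [A, B, B, A, C], [A, D, B, B, A], [B, B, D, B, B]] in
     orb gen 11
      [([Z, Z, Z, Z, A], [A, D, C, Z, Z]),
       ([Z, Z, Z, A, A], [Z, A, A, Z, Z]),
       ([Z, Z, Z, A, B], [Z, A, D, Z, A]),
       ([Z, Z, Z, A, C], [A, C, D, Z, B]),
       ([Z, Z, Z, A, D], [A, A, B, Z, A]),
       ([Z, Z, A, Z, A], [A, C, Z, Z, Z]),
       ([Z, Z, A, Z, C], [A, B, Z, A, C]),
       ([Z, Z, A, A, A], [A, A, Z, B, A]),
       ([Z, Z, A, A, B], [A, C, Z, Z, Z]),
       ([Z, Z, A, A, C], [A, C, Z, D, Z]),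
       ([Z, Z, A, B, Z], [A, Z, Z, A, A]),
       ([Z, A, Z, A, C], [A, Z, C, D, C])])"
    by code_simp
qed

text \<open>The matrix has order 3; 157 = 50 * 3 + 7.\<close>

lemma system_7: "has_system TYPE('a) 157 7 7"
proof (rule has_systemI[OF q])
  show "check 157 7 7
    (let gen = [[A, Z, Z, C, C], [Z, A, Z, C, Z], [Z, Z, A, D, A], [Z, Z, Z, C, C], [Z, Z, Z, D, A]] in
     orb gen 3
      [([Z, Z, A, Z, Z], [A, Z, Z, D, D]),
       ([Z, Z, A, Z, A], [A, D, Z, C, B]),
       ([Z, Z, A, Z, B], [A, A, Z, C, Z]),
       ([Z, Z, A, Z, C], [A, D, Z, A, C]),
       ([Z, Z, A, A, Z], [A, Z, Z, D, C]),
       ([Z, Z, A, A, C], [A, A, Z, Z, C]),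
       ([Z, Z, A, B, A], [A, B, Z, C, B]),
       ([Z, Z, A, B, B], [A, B, Z, B, Z]),
       ([Z, A, Z, Z, Z], [A, Z, Z, D, C]),
       ([Z, A, Z, A, Z], [A, Z, Z, C, D]),
       ([Z, A, A, Z, Z], [A, Z, Z, Z, A]),
       ([Z, A, A, Z, Z], [A, Z, D, C, B]),
       ([Z, A, A, Z, A], [A, Z, B, C, B]),
       ([Z, A, A, Z, B], [A, Z, C, D, A]),
       ([Z, A, A, Z, D], [A, Z, B, B, A]),
       ([Z, A, A, A, A], [A, Z, Z, C, A]),
       ([Z, A, A, A, A], [A, Z, D, D, Z]),
       ([Z, A, A, A, C], [A, Z, C, Z, C]),
       ([Z, A, A, B, Z], [A, Z, A, Z, A]),
       ([Z, A, A, B, D], [A, Z, A, D, Z]),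
       ([Z, A, B, Z, Z], [A, Z, Z, B, B]),
       ([Z, A, B, Z, Z], [A, Z, C, B, A]),
       ([Z, A, B, Z, A], [A, Z, D, Z, Z]),
       ([Z, A, B, Z, B], [A, Z, B, Z, D]),
       ([Z, A, B, Z, D], [A, Z, Z, Z, B]),
       ([Z, A, B, Z, D], [A, Z, C, D, C]),
       ([Z, A, B, A, Z], [A, Z, A, C, A]),
       ([Z, A, B, A, A], [A, Z, A, A, A]),
       ([Z, A, B, B, Z], [A, Z, D, B, B]),
       ([Z, A, B, B, D], [A, Z, B, Z, C]),
       ([Z, A, C, Z, Z], [A, Z, D, A, C]),
       ([Z, A, C, Z, A], [A, Z, C, D, B]),
       ([Z, A, C, Z, B], [A, Z, C, A, A]),
       ([Z, A, C, Z, D], [A, Z, A, B, Z]),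
       ([Z, A, C, A, Z], [A, Z, D, D, Z]),
       ([Z, A, C, A, A], [A, Z, Z, D, B]),
       ([Z, A, C, A, A], [A, Z, B, Z, Z]),
       ([Z, A, C, A, D], [A, Z, Z, Z, Z]),
       ([Z, A, C, A, D], [A, Z, B, D, B]),
       ([Z, A, C, B, C], [A, Z, A, C, D]),
       ([Z, A, D, Z, Z], [A, Z, B, C, A]),
       ([Z, A, D, Z, A], [A, Z, D, Z, B]),
       ([Z, A, D, Z, B], [A, Z, B, A, B]),
       ([Z, A, D, Z, C], [A, Z, Z, Z, B]),
       ([Z, A, D, Z, C], [A, Z, A, C, Z]),
       ([Z, A, D, A, Z], [A, Z, C, Z, D]),
       ([Z, A, D, A, A], [A, Z, D, Z, C]),
       ([Z, A, D, A, D], [A, Z, C, C, C]),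
       ([Z, A, D, C, D], [A, Z, Z, B, B]),
       ([Z, A, D, C, D], [A, Z, A, C, D])] @
     [([Z, Z, Z, Z, A], [Z, Z, Z, A, Z]),
       ([Z, Z, A, C, Z], [Z, A, Z, Z, C]),
       ([Z, Z, A, C, Z], [A, C, Z, D, Z]),
       ([Z, A, Z, Z, C], [A, Z, A, B, A]),
       ([Z, A, Z, Z, C], [A, Z, B, Z, A]),
       ([Z, A, Z, Z, C], [A, Z, C, C, A]),
       ([Z, A, Z, Z, C], [A, Z, D, A, A])])"
    by code_simp
qed

text \<open>\<open>g\<close> is the matrix of order 11 from \<open>system_6\<close>, and the fifth
  power of \<open>h\<close> is -1, which fixes every subspace; 286 = 5 * 55 + 11.\<close>

lemma system_12: "has_system TYPE('a) 286 12 12"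
proof (rule has_systemI[OF q])
  show "check 286 12 12
    (let g = [[Z, A, C, C, B], [D, B, A, C, C], [A, B, B, A, C], [A, D, B, B, A], [B, B, D, B, B]];
       h = [[Z, Z, A, Z, Z], [Z, Z, D, A, Z], [Z, Z, A, C, A], [B, A, D, C, B], [B, C, B, A, A]] in
     orb g 11 (orb h 5 [([Z, Z, Z, Z, A], [Z, A, C, C, Z]),
       ([Z, Z, Z, Z, A], [Z, A, C, D, Z]),
       ([Z, Z, Z, A, Z], [A, C, D, Z, A]),
       ([Z, Z, Z, A, A], [A, C, Z, Z, Z]),
       ([Z, Z, Z, A, B], [A, C, Z, Z, Z])]) @
     orb g 11 [([Z, Z, A, A, B], [A, C, Z, D, D])])"
    by code_simp
qed

text \<open>Made for two MRD codes, which add 10 elsewhere and nothing on the special hyperplanes,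
  so that both bounds become 13. The next two blocks likewise complete one code to 14 and two codes
  to 17.\<close>

lemma system_extension_58: "has_system TYPE('a) 58 3 13"
proof (rule has_systemI[OF q])
  show "check 58 3 13
    (let g = [[A, Z, Z, A, B], [Z, A, C, A, Z], [Z, Z, A, Z, D], [Z, Z, Z, A, C], [Z, Z, Z, Z, A]];
       h = [[A, Z, A, Z, C], [Z, A, Z, A, A], [Z, Z, A, Z, C], [Z, Z, Z, A, D], [Z, Z, Z, Z, A]];
       k = [[A, A, Z, Z, A], [C, B, Z, Z, A], [Z, Z, B, D, Z], [Z, Z, B, A, D], [Z, Z, Z, Z, B]] in
     orb g 5 (orb h 5 [([Z, A, Z, Z, B], [A, Z, Z, B, Z])]) @
     orb g 5 (orb k 3 [([Z, Z, Z, A, Z], [A, D, D, Z, Z]),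
       ([Z, Z, Z, A, Z], [A, D, D, Z, C])]) @
     orb k 3 [([Z, Z, Z, Z, A], [Z, Z, A, Z, Z])])"
    by code_simp
qed

lemma system_extension_205: "has_system TYPE('a) 205 9 14"
proof (rule has_systemI[OF q])
  show "check 205 9 14
    (let gen = [[A, A, Z, D, B], [C, B, Z, Z, Z], [Z, Z, B, C, D], [Z, Z, D, Z, D], [Z, Z, Z, Z, B]] in
     orb gen 24
      [([Z, Z, Z, A, Z], [A, Z, A, Z, A]),
       ([Z, Z, Z, A, Z], [A, D, C, Z, Z]),
       ([Z, A, Z, Z, Z], [A, Z, D, B, B]),
       ([Z, A, Z, Z, A], [A, Z, A, B, D]),
       ([Z, A, Z, Z, C], [A, Z, C, Z, C]),
       ([Z, A, Z, A, Z], [A, Z, A, C, Z]),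
       ([Z, A, Z, B, Z], [A, Z, B, D, A]),
       ([Z, A, Z, B, A], [A, Z, C, D, D])] @
     orb gen 6
      [([Z, Z, Z, Z, A], [Z, Z, Z, A, Z])] @
     orb gen 3
      [([Z, A, A, A, B], [A, Z, C, B, Z]),
       ([Z, A, A, A, B], [A, Z, C, B, D])] @
     [([Z, A, A, A, C], [A, Z, C, B, A])])"
    by code_simp
qed

lemma system_extension_162: "has_system TYPE('a) 162 7 17"
proof (rule has_systemI[OF q])
  show "check 162 7 17
    (let gen = [[Z, A, Z, Z, Z], [C, A, Z, Z, Z], [Z, Z, A, Z, Z], [Z, Z, Z, B, Z], [Z, Z, Z, Z, B]] in
     orb gen 24
      [([Z, A, Z, Z, A], [A, Z, B, B, B]),
       ([Z, A, Z, A, Z], [A, Z, A, Z, C]),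
       ([Z, A, Z, A, A], [A, Z, A, D, A]),
       ([Z, A, Z, A, B], [A, Z, B, B, C]),
       ([Z, A, Z, A, C], [A, Z, A, A, Z]),
       ([Z, A, Z, A, D], [A, Z, B, Z, A])] @
     orb gen 6
      [([Z, Z, A, Z, Z], [Z, A, Z, Z, Z])] @
     orb gen 4
      [([Z, Z, Z, A, B], [Z, Z, A, Z, A]),
       ([Z, Z, Z, A, C], [Z, Z, A, Z, A]),
       ([Z, Z, Z, A, D], [Z, Z, A, Z, A])])"
    by code_simp
qed

section \<open>Systems for \<open>s\<close> up to 93\<close>

lemmas system_mrd2 = has_system_add[OF system_mrd system_mrd]
lemmas system_mrd3 = has_system_add[OF system_mrd system_mrd2]
lemmas system_mrd4 = has_system_add[OF system_mrd2 system_mrd2]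
lemmas system_mrd5 = has_system_add[OF system_mrd system_mrd4]

lemma system_5: "has_system TYPE('a) 125 5 5"
  by (rule has_system_mono[OF system_mrd]) simp_all

lemma system_8: "has_system TYPE('a) 176 8 8"
  by (rule has_system_combine[OF system_3 system_5]) simp_all

lemma system_9: "has_system TYPE('a) 202 9 9"
  by (rule has_system_combine[OF system_4 system_5]) simp_all

lemma system_10: "has_system TYPE('a) 250 10 10"
  by (rule has_system_combine[OF system_5 system_5]) simp_all

text \<open>Two MRD codes leave the special hyperplanes free for 11 lines of the plane, which cost
  only 1 elsewhere; the cases 16 and 21 use three and four codes in the same way.\<close>

lemma system_11: "has_system TYPE('a) 261 11 11"
  by (rule has_system_combine[OF system_mrd2 system_plane_11]) simp_all

lemma system_13: "has_system TYPE('a) 308 13 13"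
  by (rule has_system_combine[OF system_mrd2 system_extension_58]) simp_all

lemma system_14: "has_system TYPE('a) 330 14 14"
  by (rule has_system_combine[OF system_mrd system_extension_205]) simp_all

lemma system_15: "has_system TYPE('a) 375 15 15"
  by (rule has_system_combine[OF system_5 system_10]) simp_all

lemma system_16: "has_system TYPE('a) 391 16 16"
  by (rule has_system_combine[OF system_mrd3 system_plane_16]) simp_all

lemma system_17: "has_system TYPE('a) 412 17 17"
  by (rule has_system_combine[OF system_mrd2 system_extension_162]) simp_all

lemma system_18: "has_system TYPE('a) 433 18 18"
  by (rule has_system_combine[OF system_5 system_13]) simp_all

lemma system_19: "has_system TYPE('a) 455 19 19"
  by (rule has_system_combine[OF system_5 system_14]) simp_all

lemma system_20: "has_system TYPE('a) 500 20 20"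
  by (rule has_system_combine[OF system_10 system_10]) simp_all

lemma system_21: "has_system TYPE('a) 521 21 21"
  by (rule has_system_combine[OF system_mrd4 system_plane_21]) simp_all

lemma system_22: "has_system TYPE('a) 544 22 22"
  by (rule has_system_combine[OF system_mrd4 system_partial_spreads_2]) simp_all

lemma system_23: "has_system TYPE('a) 569 23 23"
  by (rule has_system_combine[OF system_mrd4 system_partial_spreads_3]) simp_all

lemma system_24: "has_system TYPE('a) 596 24 24"
  by (rule has_system_combine[OF system_mrd4 system_partial_spreads_4]) simp_all

lemma system_25: "has_system TYPE('a) 625 25 25"
  by (rule has_system_combine[OF system_5 system_20]) simp_all

text \<open>Five MRD codes with \<open>y\<close> full spreads have both bounds equal to
  \<open>25 + y\<close>; this and the next five lemmas take \<open>y\<close> from 1 to 6.\<close>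

lemma system_26: "has_system TYPE('a) 651 26 26"
  by (rule has_system_combine[OF system_mrd5 system_spreads_1]) simp_all

lemma system_27: "has_system TYPE('a) 677 27 27"
  by (rule has_system_combine[OF system_mrd5 system_spreads_2]) simp_all

lemma system_28: "has_system TYPE('a) 703 28 28"
  by (rule has_system_combine[OF system_mrd5 system_spreads_3]) simp_all

lemma system_29: "has_system TYPE('a) 729 29 29"
  by (rule has_system_combine[OF system_mrd5 system_spreads_4]) simp_all

lemma system_30: "has_system TYPE('a) 755 30 30"
  by (rule has_system_combine[OF system_mrd5 system_spreads_5]) simp_all

lemma system_31: "has_system TYPE('a) 781 31 31"
  by (rule has_system_combine[OF system_mrd5 system_spreads_6]) simp_all

lemma system_32: "has_system TYPE('a) 802 32 32"
  by (rule has_system_combine[OF system_5 system_27]) simp_all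

lemma system_33: "has_system TYPE('a) 828 33 33"
  by (rule has_system_combine[OF system_5 system_28]) simp_all

lemma system_34: "has_system TYPE('a) 854 34 34"
  by (rule has_system_combine[OF system_5 system_29]) simp_all

lemma system_35: "has_system TYPE('a) 880 35 35"
  by (rule has_system_combine[OF system_5 system_30]) simp_all

lemma system_36: "has_system TYPE('a) 906 36 36"
  by (rule has_system_combine[OF system_5 system_31]) simp_all

lemma system_37: "has_system TYPE('a) 927 37 37"
  by (rule has_system_combine[OF system_10 system_27]) simp_all

lemma system_38: "has_system TYPE('a) 953 38 38"
  by (rule has_system_combine[OF system_10 system_28]) simp_all

lemma system_39: "has_system TYPE('a) 979 39 39"
  by (rule has_system_combine[OF system_10 system_29]) simp_all

lemma system_40: "has_system TYPE('a) 1005 40 40"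
  by (rule has_system_combine[OF system_10 system_30]) simp_all

lemma system_41: "has_system TYPE('a) 1031 41 41"
  by (rule has_system_combine[OF system_10 system_31]) simp_all

lemma system_42: "has_system TYPE('a) 1052 42 42"
  by (rule has_system_combine[OF system_15 system_27]) simp_all

lemma system_43: "has_system TYPE('a) 1078 43 43"
  by (rule has_system_combine[OF system_15 system_28]) simp_all

lemma system_44: "has_system TYPE('a) 1104 44 44"
  by (rule has_system_combine[OF system_15 system_29]) simp_all

lemma system_45: "has_system TYPE('a) 1130 45 45"
  by (rule has_system_combine[OF system_15 system_30]) simp_all

lemma system_46: "has_system TYPE('a) 1156 46 46"
  by (rule has_system_combine[OF system_15 system_31]) simp_all

lemma system_47: "has_system TYPE('a) 1177 47 47"
  by (rule has_system_combine[OF system_20 system_27]) simp_all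

lemma system_48: "has_system TYPE('a) 1203 48 48"
  by (rule has_system_combine[OF system_20 system_28]) simp_all

lemma system_49: "has_system TYPE('a) 1229 49 49"
  by (rule has_system_combine[OF system_20 system_29]) simp_all

lemma system_50: "has_system TYPE('a) 1255 50 50"
  by (rule has_system_combine[OF system_20 system_30]) simp_all

lemma system_51: "has_system TYPE('a) 1281 51 51"
  by (rule has_system_combine[OF system_20 system_31]) simp_all

lemma system_52: "has_system TYPE('a) 1302 52 52"
  by (rule has_system_combine[OF system_26 system_26]) simp_all

lemma system_53: "has_system TYPE('a) 1328 53 53"
  by (rule has_system_combine[OF system_26 system_27]) simp_all

lemma system_54: "has_system TYPE('a) 1354 54 54"
  by (rule has_system_combine[OF system_27 system_27]) simp_all

lemma system_55: "has_system TYPE('a) 1380 55 55"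
  by (rule has_system_combine[OF system_27 system_28]) simp_all

lemma system_56: "has_system TYPE('a) 1406 56 56"
  by (rule has_system_combine[OF system_28 system_28]) simp_all

lemma system_57: "has_system TYPE('a) 1432 57 57"
  by (rule has_system_combine[OF system_28 system_29]) simp_all

lemma system_58: "has_system TYPE('a) 1458 58 58"
  by (rule has_system_combine[OF system_29 system_29]) simp_all

lemma system_59: "has_system TYPE('a) 1484 59 59"
  by (rule has_system_combine[OF system_29 system_30]) simp_all

lemma system_60: "has_system TYPE('a) 1510 60 60"
  by (rule has_system_combine[OF system_30 system_30]) simp_all

lemma system_61: "has_system TYPE('a) 1536 61 61"
  by (rule has_system_combine[OF system_30 system_31]) simp_all

lemma system_62: "has_system TYPE('a) 1562 62 62"
  by (rule has_system_combine[OF system_31 system_31]) simp_all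

lemma system_63: "has_system TYPE('a) 1583 63 63"
  by (rule has_system_combine[OF system_31 system_32]) simp_all

lemma system_64: "has_system TYPE('a) 1609 64 64"
  by (rule has_system_combine[OF system_31 system_33]) simp_all

lemma system_65: "has_system TYPE('a) 1635 65 65"
  by (rule has_system_combine[OF system_31 system_34]) simp_all

lemma system_66: "has_system TYPE('a) 1661 66 66"
  by (rule has_system_combine[OF system_31 system_35]) simp_all

lemma system_67: "has_system TYPE('a) 1687 67 67"
  by (rule has_system_combine[OF system_31 system_36]) simp_all

lemma system_68: "has_system TYPE('a) 1708 68 68"
  by (rule has_system_combine[OF system_34 system_34]) simp_all

lemma system_69: "has_system TYPE('a) 1734 69 69"
  by (rule has_system_combine[OF system_34 system_35]) simp_all

lemma system_70: "has_system TYPE('a) 1760 70 70"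
  by (rule has_system_combine[OF system_35 system_35]) simp_all

lemma system_71: "has_system TYPE('a) 1786 71 71"
  by (rule has_system_combine[OF system_35 system_36]) simp_all

lemma system_72: "has_system TYPE('a) 1812 72 72"
  by (rule has_system_combine[OF system_36 system_36]) simp_all

lemma system_73: "has_system TYPE('a) 1833 73 73"
  by (rule has_system_combine[OF system_36 system_37]) simp_all

lemma system_74: "has_system TYPE('a) 1859 74 74"
  by (rule has_system_combine[OF system_36 system_38]) simp_all

lemma system_75: "has_system TYPE('a) 1885 75 75"
  by (rule has_system_combine[OF system_36 system_39]) simp_all

lemma system_76: "has_system TYPE('a) 1911 76 76"
  by (rule has_system_combine[OF system_36 system_40]) simp_all

lemma system_77: "has_system TYPE('a) 1937 77 77"
  by (rule has_system_combine[OF system_36 system_41]) simp_all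

lemma system_78: "has_system TYPE('a) 1958 78 78"
  by (rule has_system_combine[OF system_39 system_39]) simp_all

lemma system_79: "has_system TYPE('a) 1984 79 79"
  by (rule has_system_combine[OF system_39 system_40]) simp_all

lemma system_80: "has_system TYPE('a) 2010 80 80"
  by (rule has_system_combine[OF system_40 system_40]) simp_all

lemma system_81: "has_system TYPE('a) 2036 81 81"
  by (rule has_system_combine[OF system_40 system_41]) simp_all

lemma system_82: "has_system TYPE('a) 2062 82 82"
  by (rule has_system_combine[OF system_41 system_41]) simp_all

lemma system_83: "has_system TYPE('a) 2083 83 83"
  by (rule has_system_combine[OF system_41 system_42]) simp_all

lemma system_84: "has_system TYPE('a) 2109 84 84"
  by (rule has_system_combine[OF system_41 system_43]) simp_all

lemma system_85: "has_system TYPE('a) 2135 85 85"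
  by (rule has_system_combine[OF system_41 system_44]) simp_all

lemma system_86: "has_system TYPE('a) 2161 86 86"
  by (rule has_system_combine[OF system_41 system_45]) simp_all

lemma system_87: "has_system TYPE('a) 2187 87 87"
  by (rule has_system_combine[OF system_41 system_46]) simp_all

lemma system_88: "has_system TYPE('a) 2213 88 88"
  by (rule has_system_combine[OF system_31 system_57]) simp_all

lemma system_89: "has_system TYPE('a) 2239 89 89"
  by (rule has_system_combine[OF system_31 system_58]) simp_all

lemma system_90: "has_system TYPE('a) 2265 90 90"
  by (rule has_system_combine[OF system_31 system_59]) simp_all

lemma system_91: "has_system TYPE('a) 2291 91 91"
  by (rule has_system_combine[OF system_31 system_60]) simp_all

lemma system_92: "has_system TYPE('a) 2317 92 92"
  by (rule has_system_combine[OF system_31 system_61]) simp_all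

lemma system_93: "has_system TYPE('a) 2343 93 93"
  by (rule has_system_combine[OF system_31 system_62]) simp_all

lemmas systems =
    system_2 system_3 system_4 system_5 system_6 system_7
    system_8 system_9 system_10 system_11 system_12 system_13
    system_14 system_15 system_16 system_17 system_18 system_19
    system_20 system_21 system_22 system_23 system_24 system_25
    system_26 system_27 system_28 system_29 system_30 system_31
    system_32 system_33 system_34 system_35 system_36 system_37
    system_38 system_39 system_40 system_41 system_42 system_43
    system_44 system_45 system_46 system_47 system_48 system_49
    system_50 system_51 system_52 system_53 system_54 system_55
    system_56 system_57 system_58 system_59 system_60 system_61
    system_62 system_63 system_64 system_65 system_66 system_67
    system_68 system_69 system_70 system_71 system_72 system_73
    system_74 system_75 system_76 system_77 system_78 system_79
    system_80 system_81 system_82 system_83 system_84 system_85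
    system_86 system_87 system_88 system_89 system_90 system_91
    system_92 system_93

section \<open>Periodicity in \<open>s\<close>\<close>

text \<open>Each copy of \<open>system_31\<close> raises \<open>s\<close> by 31 and the size by 781.
  The difference then grows by 750 and the three quotients by 150 + 30 + 6 = 6 * 31, so failure of
  the Griesmer inequality persists. The complements \<open>i\<close> and \<open>a\<close> to 93 and
  2343 = 3 * 781 make \<open>t = 3\<close> the base case.\<close>

lemma max_system_size_period:
  assumes "has_system TYPE('a) n s s" "s + i = 93" "n + a = 2343"
    and gr: "6 * s < (n + 1 - s + 4) div 5 + (n + 1 - s + 24) div 25 + (n + 1 - s + 124) div 125"
    and "3 \<le> t"
  shows "max_system_size TYPE('a ^ 5) 2 (31 * t - i) = 781 * t - a"
proof -
  obtain k where t: "t = k + 3" using assms(5) by (metis add.commute le_Suc_ex)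
  have "31 * t = 31 * k + s + i" "781 * t = 781 * k + n + a"
    using assms(2,3) unfolding t by simp_all
  then have s: "31 * t - i = 31 * k + s" and n: "781 * t - a = 781 * k + n"
    by simp_all
  have "has_system TYPE('a) (781 * k + n) (31 * k + s) (31 * k + s)"
  proof (induction k)
    case (Suc k)
    show ?case by (rule has_system_combine[OF system_31 Suc.IH]) simp_all
  qed (use assms(1) in simp)
  then have "781 * k + n \<le> max_system_size TYPE('a ^ 5) 2 (31 * k + s)"
    by (rule max_system_size_geI) simp
  moreover have "max_system_size TYPE('a ^ 5) 2 (31 * k + s) \<le> 781 * k + n"
  proof (rule max_system_size_le_griesmer)
    define d where "d = n + 1 - s"
    \<comment> \<open>Otherwise the truncated difference in \<open>gr\<close> is 0 and its right
      side vanishes.\<close>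
    have "s \<le> n + 1" using gr by (cases "s \<le> n + 1") auto
    then have d: "781 * k + n + 1 - (31 * k + s) = 750 * k + d" unfolding d_def by linarith
    have e1: "(750 * k + d + 4) div 5 = 150 * k + (d + 4) div 5"
      using div_mult_self2[of 5 "d + 4" "150 * k"] by (simp add: algebra_simps)
    have e2: "(750 * k + d + 24) div 25 = 30 * k + (d + 24) div 25"
      using div_mult_self2[of 25 "d + 24" "30 * k"] by (simp add: algebra_simps)
    have e3: "(750 * k + d + 124) div 125 = 6 * k + (d + 124) div 125"
      using div_mult_self2[of 125 "d + 124" "6 * k"] by (simp add: algebra_simps)
    show "6 * (31 * k + s) < (781 * k + n + 1 - (31 * k + s) + 4) div 5
        + (781 * k + n + 1 - (31 * k + s) + 24) div 25 + (781 * k + n + 1 - (31 * k + s) + 124) div 125"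
      unfolding d e1 e2 e3 using gr unfolding d_def[symmetric] by simp
  qed
  ultimately show ?thesis unfolding s n by simp
qed

end

theorem theorem7:
  assumes "CARD('a::{field,finite}) = 5"
  shows "let n = max_system_size TYPE('a ^ 5) 2 in
       (27 \<le> n 2 \<and> n 2 \<le> 31 \<and>
        50 \<le> n 3 \<and> n 3 \<le> 62 \<and>
        77 \<le> n 4 \<and> n 4 \<le> 93 \<and>
        n 5 = 125 \<and>
        132 \<le> n 6 \<and> n 6 \<le> 146 \<and>
        157 \<le> n 7 \<and> n 7 \<le> 172 \<and>
        176 \<le> n 8 \<and> n 8 \<le> 198 \<and>
        202 \<le> n 9 \<and> n 9 \<le> 224 \<and>
        n 10 = 250 \<and>
        260 \<le> n 11 \<and> n 11 \<le> 271 \<and>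
        286 \<le> n 12 \<and> n 12 \<le> 297 \<and>
        308 \<le> n 13 \<and> n 13 \<le> 323 \<and>
        330 \<le> n 14 \<and> n 14 \<le> 349 \<and>
        n 15 = 375 \<and>
        391 \<le> n 16 \<and> n 16 \<le> 396 \<and>
        412 \<le> n 17 \<and> n 17 \<le> 422 \<and>
        433 \<le> n 18 \<and> n 18 \<le> 448 \<and>
        455 \<le> n 19 \<and> n 19 \<le> 474 \<and>
        n 20 = 500 \<and>
        n 21 = 521 \<and>
        542 \<le> n 22 \<and> n 22 \<le> 547 \<and>
        568 \<le> n 23 \<and> n 23 \<le> 573 \<and>
        594 \<le> n 24 \<and> n 24 \<le> 599 \<and>
        n 25 = 625 \<and>
        n 26 = 651 \<and>
        667 \<le> n 27 \<and> n 27 \<le> 677 \<and>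
        693 \<le> n 28 \<and> n 28 \<le> 703 \<and>
        719 \<le> n 29 \<and> n 29 \<le> 729 \<and>
        n 30 = 755 \<and>
        n 31 = 781) \<and>
       (792 \<le> n 32 \<and> n 32 \<le> 802 \<and>
        818 \<le> n 33 \<and> n 33 \<le> 828 \<and>
        844 \<le> n 34 \<and> n 34 \<le> 854 \<and>
        n 35 = 880 \<and>
        n 36 = 906 \<and>
        n 37 = 927 \<and>
        941 \<le> n 38 \<and> n 38 \<le> 953 \<and>
        969 \<le> n 39 \<and> n 39 \<le> 979 \<and>
        n 40 = 1005 \<and>
        n 41 = 1031 \<and>
        n 42 = 1052 \<and>
        1067 \<le> n 43 \<and> n 43 \<le> 1078 \<and>
        1096 \<le> n 44 \<and> n 44 \<le> 1104 \<and>
        n 45 = 1130 \<and>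
        n 46 = 1156 \<and>
        n 47 = 1177 \<and>
        n 48 = 1203 \<and>
        1224 \<le> n 49 \<and> n 49 \<le> 1229 \<and>
        n 50 = 1255 \<and>
        n 51 = 1281 \<and>
        n 52 = 1302 \<and>
        n 53 = 1328 \<and>
        n 54 = 1354 \<and>
        n 55 = 1380 \<and>
        n 56 = 1406 \<and>
        n 57 = 1432 \<and>
        n 58 = 1458 \<and>
        n 59 = 1484 \<and>
        n 60 = 1510 \<and>
        n 61 = 1536 \<and>
        n 62 = 1562) \<and>
       (\<forall>t::nat. t \<ge> 3 \<longrightarrow>
        n (31 * t - 30) = 781 * t - 760 \<and>
        n (31 * t - 29) = 781 * t - 734 \<and>
        n (31 * t - 28) = 781 * t - 708 \<and>
        n (31 * t - 27) = 781 * t - 682 \<and>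
        n (31 * t - 26) = 781 * t - 656 \<and>
        n (31 * t - 25) = 781 * t - 635 \<and>
        n (31 * t - 24) = 781 * t - 609 \<and>
        n (31 * t - 23) = 781 * t - 583 \<and>
        n (31 * t - 22) = 781 * t - 557 \<and>
        n (31 * t - 21) = 781 * t - 531 \<and>
        n (31 * t - 20) = 781 * t - 510 \<and>
        n (31 * t - 19) = 781 * t - 484 \<and>
        n (31 * t - 18) = 781 * t - 458 \<and>
        n (31 * t - 17) = 781 * t - 432 \<and>
        n (31 * t - 16) = 781 * t - 406 \<and>
        n (31 * t - 15) = 781 * t - 385 \<and>
        n (31 * t - 14) = 781 * t - 359 \<and>
        n (31 * t - 13) = 781 * t - 333 \<and>
        n (31 * t - 12) = 781 * t - 307 \<and>
        n (31 * t - 11) = 781 * t - 281 \<and>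
        n (31 * t - 10) = 781 * t - 260 \<and>
        n (31 * t - 9) = 781 * t - 234 \<and>
        n (31 * t - 8) = 781 * t - 208 \<and>
        n (31 * t - 7) = 781 * t - 182 \<and>
        n (31 * t - 6) = 781 * t - 156 \<and>
        n (31 * t - 5) = 781 * t - 130 \<and>
        n (31 * t - 4) = 781 * t - 104 \<and>
        n (31 * t - 3) = 781 * t - 78 \<and>
        n (31 * t - 2) = 781 * t - 52 \<and>
        n (31 * t - 1) = 781 * t - 26 \<and>
        n (31 * t) = 781 * t)"
proof -
  let ?n = "max_system_size TYPE('a ^ 5) 2"
  note q = assms
  \<comment> \<open>Some systems exceed the claimed bound, such as 51 lines for
    \<open>s = 3\<close>; the premise \<open>m \<le> n\<close> absorbs the surplus.\<close>
  note lower = systems[OF q, THEN max_system_size_geI[OF q]]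
  note upper = max_system_size_le_griesmer[OF q]
  note period = systems[OF q, THEN max_system_size_period[OF q]]
  \<comment> \<open>Residue 0 is separate because \<open>31 * t\<close> has no subtracted term to
    match \<open>i\<close>.\<close>
  have period_0: "?n (31 * t) = 781 * t" if "3 \<le> t" for t
    using max_system_size_period[OF q system_93[OF q], of 0 0] that by simp
  \<comment> \<open>Only \<open>s\<close> = 2, 3, 4 fall back on this bound: there the Griesmer
    inequality still admits larger sizes.\<close>
  note lines = max_system_size_le_lines[OF q]
  have "27 \<le> ?n 2 \<and> ?n 2 \<le> 31 \<and>
        50 \<le> ?n 3 \<and> ?n 3 \<le> 62 \<and>
        77 \<le> ?n 4 \<and> ?n 4 \<le> 93 \<and>
        ?n 5 = 125 \<and>
        132 \<le> ?n 6 \<and> ?n 6 \<le> 146 \<and>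
        157 \<le> ?n 7 \<and> ?n 7 \<le> 172 \<and>
        176 \<le> ?n 8 \<and> ?n 8 \<le> 198 \<and>
        202 \<le> ?n 9 \<and> ?n 9 \<le> 224 \<and>
        ?n 10 = 250 \<and>
        260 \<le> ?n 11 \<and> ?n 11 \<le> 271 \<and>
        286 \<le> ?n 12 \<and> ?n 12 \<le> 297 \<and>
        308 \<le> ?n 13 \<and> ?n 13 \<le> 323 \<and>
        330 \<le> ?n 14 \<and> ?n 14 \<le> 349 \<and>
        ?n 15 = 375 \<and>
        391 \<le> ?n 16 \<and> ?n 16 \<le> 396 \<and>
        412 \<le> ?n 17 \<and> ?n 17 \<le> 422 \<and>
        433 \<le> ?n 18 \<and> ?n 18 \<le> 448 \<and>
        455 \<le> ?n 19 \<and> ?n 19 \<le> 474 \<and>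
        ?n 20 = 500 \<and>
        ?n 21 = 521 \<and>
        542 \<le> ?n 22 \<and> ?n 22 \<le> 547 \<and>
        568 \<le> ?n 23 \<and> ?n 23 \<le> 573 \<and>
        594 \<le> ?n 24 \<and> ?n 24 \<le> 599 \<and>
        ?n 25 = 625 \<and>
        ?n 26 = 651 \<and>
        667 \<le> ?n 27 \<and> ?n 27 \<le> 677 \<and>
        693 \<le> ?n 28 \<and> ?n 28 \<le> 703 \<and>
        719 \<le> ?n 29 \<and> ?n 29 \<le> 729 \<and>
        ?n 30 = 755 \<and>
        ?n 31 = 781"
    by (intro conjI antisym; ((rule lower, (simp; fail)) | (rule upper, (simp; fail)) | (rule order_trans[OF lines], simp add: dvd_eq_mod_eq_0, simp)))
  moreover have "792 \<le> ?n 32 \<and> ?n 32 \<le> 802 \<and>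
        818 \<le> ?n 33 \<and> ?n 33 \<le> 828 \<and>
        844 \<le> ?n 34 \<and> ?n 34 \<le> 854 \<and>
        ?n 35 = 880 \<and>
        ?n 36 = 906 \<and>
        ?n 37 = 927 \<and>
        941 \<le> ?n 38 \<and> ?n 38 \<le> 953 \<and>
        969 \<le> ?n 39 \<and> ?n 39 \<le> 979 \<and>
        ?n 40 = 1005 \<and>
        ?n 41 = 1031 \<and>
        ?n 42 = 1052 \<and>
        1067 \<le> ?n 43 \<and> ?n 43 \<le> 1078 \<and>
        1096 \<le> ?n 44 \<and> ?n 44 \<le> 1104 \<and>
        ?n 45 = 1130 \<and>
        ?n 46 = 1156 \<and>
        ?n 47 = 1177 \<and>
        ?n 48 = 1203 \<and>
        1224 \<le> ?n 49 \<and> ?n 49 \<le> 1229 \<and>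
        ?n 50 = 1255 \<and>
        ?n 51 = 1281 \<and>
        ?n 52 = 1302 \<and>
        ?n 53 = 1328 \<and>
        ?n 54 = 1354 \<and>
        ?n 55 = 1380 \<and>
        ?n 56 = 1406 \<and>
        ?n 57 = 1432 \<and>
        ?n 58 = 1458 \<and>
        ?n 59 = 1484 \<and>
        ?n 60 = 1510 \<and>
        ?n 61 = 1536 \<and>
        ?n 62 = 1562"
    by (intro conjI antisym; ((rule lower, (simp; fail)) | (rule upper, (simp; fail))))
  moreover have "\<forall>t::nat. t \<ge> 3 \<longrightarrow>
        ?n (31 * t - 30) = 781 * t - 760 \<and>
        ?n (31 * t - 29) = 781 * t - 734 \<and>
        ?n (31 * t - 28) = 781 * t - 708 \<and>
        ?n (31 * t - 27) = 781 * t - 682 \<and>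
        ?n (31 * t - 26) = 781 * t - 656 \<and>
        ?n (31 * t - 25) = 781 * t - 635 \<and>
        ?n (31 * t - 24) = 781 * t - 609 \<and>
        ?n (31 * t - 23) = 781 * t - 583 \<and>
        ?n (31 * t - 22) = 781 * t - 557 \<and>
        ?n (31 * t - 21) = 781 * t - 531 \<and>
        ?n (31 * t - 20) = 781 * t - 510 \<and>
        ?n (31 * t - 19) = 781 * t - 484 \<and>
        ?n (31 * t - 18) = 781 * t - 458 \<and>
        ?n (31 * t - 17) = 781 * t - 432 \<and>
        ?n (31 * t - 16) = 781 * t - 406 \<and>
        ?n (31 * t - 15) = 781 * t - 385 \<and>
        ?n (31 * t - 14) = 781 * t - 359 \<and>
        ?n (31 * t - 13) = 781 * t - 333 \<and>
        ?n (31 * t - 12) = 781 * t - 307 \<and>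
        ?n (31 * t - 11) = 781 * t - 281 \<and>
        ?n (31 * t - 10) = 781 * t - 260 \<and>
        ?n (31 * t - 9) = 781 * t - 234 \<and>
        ?n (31 * t - 8) = 781 * t - 208 \<and>
        ?n (31 * t - 7) = 781 * t - 182 \<and>
        ?n (31 * t - 6) = 781 * t - 156 \<and>
        ?n (31 * t - 5) = 781 * t - 130 \<and>
        ?n (31 * t - 4) = 781 * t - 104 \<and>
        ?n (31 * t - 3) = 781 * t - 78 \<and>
        ?n (31 * t - 2) = 781 * t - 52 \<and>
        ?n (31 * t - 1) = 781 * t - 26 \<and>
        ?n (31 * t) = 781 * t"
    by (intro allI impI conjI;
      ((rule period, (simp; fail), (simp; fail), (simp; fail), assumption) | (rule period_0, assumption)))
  ultimately show ?thesis unfolding Let_def by blast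
qed

end
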